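(* Let $\mu$ be a valuation on $K[x]$ extending $v$. The defect of each augmentation step in a Mac Lane-Vaquié chain of $\mu$ does not depend on the choice of the chain. That is, if $$(v\xrightarrow{\phi_0})\mu_0\xrightarrow{\phi_1}\mu_1\xrightarrow{\phi_2}\cdots\longrightarrow\mu_n\xrightarrow{\phi_{n+1}}\mu_{n+1}\longrightarrow\cdots\longrightarrow\mu$$ and $$(v\xrightarrow{\psi_0})w_0\xrightarrow{\psi_1}w_1\xrightarrow{\psi_2}\cdots\longrightarrow w_n\xrightarrow{\psi_{n+1}}w_{n+1}\longrightarrow\cdots\longrightarrow\mu$$ are two Mac Lane-Vaquié chains of $\mu$, then $d(\mu_n\to\mu_{n+1})=d(w_n\to w_{n+1})$ for every augmentation step $n$.
   Context: Setting: $(K,v)$ is a valued field of arbitrary rank, $\bar v$ an extension of $v$ to a fixed algebraic closure $\overline K$, with value group $\Gamma_{\bar v}$, and $\Gamma$ is an ordered abelian group containing $\Gamma_{\bar v}$. A valuation on $K[x]$ means a map $\mu:K[x]\to\Gamma\infty:=\Gamma\cup\{\infty\}$ extending $v$ with $\mu(fg)=\mu(f)+\mu(g)$, $\mu(f+g)\ge\min\{\mu(f),\mu(g)\}$; the prime ideal $\operatorname{supp}(\mu)=\mu^{-1}(\infty)$ may be nonzero. Write $\mu\le\nu$ if $\mu(f)\le\nu(f)$ for all $f\in K[x]$. Key polynomials: for $\mu$ with $\operatorname{supp}(\mu)=\{0\}$, $f\sim_\mu g$ means $\mu(f-g)>\mu(f)=\mu(g)$; $f\mid_\mu g$ means $g\sim_\mu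 fh$ for some $h\in K[x]$. A monic $\phi\in K[x]$ is a key polynomial for $\mu$ if (i) $\phi\mid_\mu fg$ implies $\phi\mid_\mu f$ or $\phi\mid_\mu g$, and (ii) $\phi\mid_\mu f$ with $f\ne0$ implies $\deg f\ge\deg\phi$. $\operatorname{KP}(\mu)$ is the set of key polynomials ($\emptyset$ if the support is nonzero). If $\operatorname{KP}(\mu)\neq\emptyset$, $\deg(\mu)$ is the minimal degree of a key polynomial for $\mu$; if $\operatorname{supp}(\mu)=\phi K[x]\ne0$, $\deg(\mu)=\deg\phi$. Tangent direction: for $\mu<\nu$, $\Phi(\mu,\nu)$ is the set of monic $g\in K[x]$ of minimal degree with $\mu(g)<\nu(g)$, and $\deg(\Phi(\mu,\nu))$ is that minimal degree. It is known that $\Phi(\mu,\nu)\subset\operatorname{KP}(\mu)$. Ordinary augmentation: for $\phi\in\operatorname{KP}(\mu)$ and $\gamma\in\Gamma\infty$ with $\gamma>\mu(\phi)$, $[\mu;\phi,\gamma]$ is the valuation $f\mapsto\min_i\{\mu(f_i)+i\gamma\}$, where $f=\sum_i f_i\phi^i$, $\deg f_i<\deg\phi$, is the $\phi$-expansion of $f$. Continuous families: a family $\mathcal C=(\rho_i)_{i\in\mathbf A}$ of valuations on $K[x]$, indexed by a well-ordered set $\mathbf A$ without last element, is continuous if $i\mapsto\rho_i$ is an isomorphism of totally ordered sets and $\deg(\rho_i)$ is eventually constant, with eventual value $\deg(\mathcal C)$. It is a continuous family of augmentations of $\mu$ if each $\rho_i=[\mu;\chi_i,\beta_i]$ is an ordinary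 augmentation of $\mu$. A polynomial $f$ is $\mathcal C$-stable if $\rho_i(f)$ is eventually constant in $i$, with eventual value $\rho_{\mathcal C}(f)$; otherwise $\mathcal C$-unstable. If all polynomials are stable, $\rho_{\mathcal C}$ is a valuation, the stable limit of $\mathcal C$. Let $m_\infty$ be the minimal degree of a $\mathcal C$-unstable polynomial ($\infty$ if none). $\mathcal C$ is essential if $\deg(\mathcal C)<m_\infty<\infty$. Limit key polynomials for $\mathcal C$ are the monic $\mathcal C$-unstable polynomials of degree $m_\infty<\infty$. Limit augmentation: for a limit key polynomial $\phi$ of $\mathcal C$ and $\gamma\in\Gamma\infty$ with $\gamma>\rho_i(\phi)$ for all $i$, $[\mathcal C;\phi,\gamma]$ is the valuation $f\mapsto\min_i\{\rho_{\mathcal C}(f_i)+i\gamma\}$, with $f=\sum f_i\phi^i$ the $\phi$-expansion. If $\mathcal C$ is a continuous family of augmentations of $\mu$, one says $\mu\to\nu=[\mathcal C;\phi,\gamma]$ is a limit augmentation. Mac Lane-Vaquié (MLV) chain: a finite or countably infinite chain $(v\xrightarrow{\phi_0,\gamma_0})\mu_0\xrightarrow{\phi_1,\gamma_1}\mu_1\to\cdots$ where $\phi_0=x-\alpha_0$ with $\alpha_0\in K$, $\mu_0(\sum c_i(x-\alpha_0)^i)=\min_i\{v(c_i)+i\gamma_0\}$, and each step $\mu_n\to\mu_{n+1}$ is either (i) ordinary: $\mu_{n+1}=[\mu_n;\phi_{n+1},\gamma_{n+1}]$ with $\deg(\mu_n)<\deg(\Phi(\mu_n,\mu_{n+1}))$;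 or (ii) limit: $\mu_{n+1}=[\mathcal C;\phi_{n+1},\gamma_{n+1}]$ with $\mathcal C$ an essential continuous family of augmentations of $\mu_n$, $\deg(\mu_n)=\deg(\Phi(\mu_n,\mu_{n+1}))<\deg(\mu_{n+1})$ and $\phi_n\notin\Phi(\mu_n,\mu_{n+1})$. MLV chain of $\mu$: an MLV chain such that either (Type 1) it is finite with last valuation $\mu_r=\mu$; or (Type 2) it is finite with last valuation $\mu_r$, and $\mu$ is the stable limit of a continuous family of augmentations of $\mu_r$, with $\deg(\Phi(\mu_r,\mu))=\deg(\mu_r)$ and $\phi_r\notin\Phi(\mu_r,\mu)$; or (Type 3) it is infinite and $\mu$ is its stable limit (for every $f$, $\mu_n(f)=\mu(f)$ for all large $n$). It is known that every valuation on $K[x]$ has an MLV chain and that the number of steps and the nature (ordinary/limit) of each step depend only on $\mu$. Defect of an augmentation $\mu\to\nu$ (ordinary or limit): for $Q\in\Phi(\mu,\nu)$ put $\rho_Q=[\mu;Q,\nu(Q)]$, and for $f=\sum_i f_iQ^i$ ($Q$-expansion) put $\deg_{\rho_Q}(f)=\max\{i:\rho_Q(f_iQ^i)=\rho_Q(f)\}$. Let $\phi$ be a key polynomial of minimal degree for $\nu$, or a monic generator of $\operatorname{supp}(\nu)$ if this is nonzero. Then $d(\mu\to\nu)=\min\{\deg_{\rho_Q}(\phi): Q\in\Phi(\mu,\nu)\}$; this is known to be independent of the choice of $\phi$. *)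

theory Defs
  imports
    "HOL-Library.Extended_Nat"
    "HOL-Algebra.Algebraic_Closure_Type"
    "HOL-Computational_Algebra.Polynomial"
begin

section \<open>The value domain: an ordered abelian group with a largest element adjoined\<close>

datatype 'g infty = Fin 'g | Infty

instantiation infty :: (linorder) linorder
begin

definition less_eq_infty :: "'g::linorder infty \<Rightarrow> 'g infty \<Rightarrow> bool" where
  "less_eq_infty a b \<longleftrightarrow>
     (case b of Infty \<Rightarrow> True | Fin y \<Rightarrow> (case a of Infty \<Rightarrow> False | Fin x \<Rightarrow> x \<le> y))"

definition less_infty :: "'g::linorder infty \<Rightarrow> 'g infty \<Rightarrow> bool" where
  "less_infty a b \<longleftrightarrow> a \<le> b \<and> \<not> b \<le> a"

instance
  by intro_classes (auto simp: less_eq_infty_def less_infty_def split: infty.splits)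

end

instantiation infty :: (comm_monoid_add) comm_monoid_add
begin

definition zero_infty :: "'g::comm_monoid_add infty" where
  "zero_infty = Fin 0"

definition plus_infty :: "'g::comm_monoid_add infty \<Rightarrow> 'g infty \<Rightarrow> 'g infty" where
  "plus_infty a b =
     (case a of Infty \<Rightarrow> Infty | Fin x \<Rightarrow> (case b of Infty \<Rightarrow> Infty | Fin y \<Rightarrow> Fin (x + y)))"

instance
  by intro_classes
    (auto simp: zero_infty_def plus_infty_def ac_simps split: infty.splits)

end

text \<open>The multiple \<open>i\<gamma>\<close>; in particular \<open>0\<infinity> = 0\<close>.\<close>

definition nat_mult :: "nat \<Rightarrow> 'g::comm_monoid_add infty \<Rightarrow> 'g infty" where
  "nat_mult i \<gamma> = (\<Sum>j<i. \<gamma>)"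


section \<open>Valuations\<close>

definition field_valuation :: "('k::field \<Rightarrow> 'g::linordered_ab_group_add infty) \<Rightarrow> bool" where
  "field_valuation v \<longleftrightarrow>
     (\<forall>a. v a = Infty \<longleftrightarrow> a = 0) \<and>
     (\<forall>a b. v (a * b) = v a + v b) \<and>
     (\<forall>a b. min (v a) (v b) \<le> v (a + b))"

text \<open>The pointwise order on maps \<open>K[x] \<rightarrow> \<Gamma>\<infinity>\<close> is the library's order on functions.\<close>

type_synonym ('k, 'g) pmap = "'k poly \<Rightarrow> 'g infty"

definition poly_valuation ::
    "('k::field \<Rightarrow> 'g::linordered_ab_group_add infty) \<Rightarrow> ('k, 'g) pmap \<Rightarrow> bool" where
  "poly_valuation v \<mu> \<longleftrightarrow>
     (\<forall>c. \<mu> [:c:] = v c) \<and>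
     (\<forall>f g. \<mu> (f * g) = \<mu> f + \<mu> g) \<and>
     (\<forall>f g. min (\<mu> f) (\<mu> g) \<le> \<mu> (f + g))"

definition support :: "('k::field, 'g) pmap \<Rightarrow> 'k poly set" where
  "support \<mu> = {f. \<mu> f = Infty}"

definition support_generators :: "('k::field, 'g) pmap \<Rightarrow> 'k poly set" where
  "support_generators \<mu> = {\<phi>. lead_coeff \<phi> = 1 \<and> support \<mu> = {\<phi> * h | h. True}}"


section \<open>Key polynomials\<close>

definition val_equiv :: "('k::field, 'g::linordered_ab_group_add) pmap \<Rightarrow> 'k poly \<Rightarrow> 'k poly \<Rightarrow> bool" where
  "val_equiv \<mu> f g \<longleftrightarrow> \<mu> f = \<mu> g \<and> \<mu> f < \<mu> (f - g)"

definition val_dvd :: "('k::field, 'g::linordered_ab_group_add) pmap \<Rightarrow> 'k poly \<Rightarrow> 'k poly \<Rightarrow> bool" where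
  "val_dvd \<mu> f g \<longleftrightarrow> (\<exists>h. val_equiv \<mu> g (f * h))"

text \<open>
  Condition (i) in the definition of a key polynomial \<open>\<phi>\<close> says that \<open>\<phi>\<close> generates a prime
  ideal in the graded algebra of \<open>\<mu>\<close>. A prime ideal is proper, which is the condition
  \<open>\<not> val_dvd \<mu> \<phi> 1\<close>; its only effect is to exclude the constant polynomial 1.
\<close>

definition KP :: "('k::field, 'g::linordered_ab_group_add) pmap \<Rightarrow> 'k poly set" where
  "KP \<mu> = {\<phi>. support \<mu> = {0} \<and> lead_coeff \<phi> = 1 \<and> \<not> val_dvd \<mu> \<phi> 1 \<and>
     (\<forall>f g. val_dvd \<mu> \<phi> (f * g) \<longrightarrow> val_dvd \<mu> \<phi> f \<or> val_dvd \<mu> \<phi> g) \<and>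
     (\<forall>f. val_dvd \<mu> \<phi> f \<and> f \<noteq> 0 \<longrightarrow> degree \<phi> \<le> degree f)}"

text \<open>
  Only meaningful if \<open>KP \<mu>\<close> is nonempty or the support is nonzero; this holds for all
  valuations to which it is applied in a Mac Lane--Vaquie chain.
\<close>

definition val_degree :: "('k::field, 'g::linordered_ab_group_add) pmap \<Rightarrow> nat" where
  "val_degree \<mu> =
     (if support \<mu> = {0} then (LEAST d. \<exists>\<phi>\<in>KP \<mu>. degree \<phi> = d)
      else (LEAST d. \<exists>\<phi>\<in>support_generators \<mu>. degree \<phi> = d))"

definition tangent_degree ::
    "('k::field, 'g::linordered_ab_group_add) pmap \<Rightarrow> ('k, 'g) pmap \<Rightarrow> nat" where
  "tangent_degree \<mu> \<nu> = (LEAST d. \<exists>g. lead_coeff g = 1 \<and> \<mu> g < \<nu> g \<and> degree g = d)"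

definition tangent_direction ::
    "('k::field, 'g::linordered_ab_group_add) pmap \<Rightarrow> ('k, 'g) pmap \<Rightarrow> 'k poly set" where
  "tangent_direction \<mu> \<nu> = {g. lead_coeff g = 1 \<and> \<mu> g < \<nu> g \<and> degree g = tangent_degree \<mu> \<nu>}"


section \<open>Expansions and ordinary augmentations\<close>

text \<open>
  The \<open>\<phi>\<close>-expansion \<open>f = \<Sum>\<^sub>i f\<^sub>i \<phi>\<^sup>i\<close> is the polynomial over \<open>K[x]\<close> with coefficients \<open>f\<^sub>i\<close>
  of degree less than that of \<open>\<phi>\<close> and value \<open>f\<close> at \<open>\<phi>\<close>.
\<close>

definition is_expansion :: "'k::field poly \<Rightarrow> 'k poly \<Rightarrow> 'k poly poly \<Rightarrow> bool" where
  "is_expansion \<phi> f F \<longleftrightarrow> poly F \<phi> = f \<and> (\<forall>i. degree (coeff F i) < degree \<phi>)"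

definition expansion :: "'k::field poly \<Rightarrow> 'k poly \<Rightarrow> 'k poly poly" where
  "expansion \<phi> f = (THE F. is_expansion \<phi> f F)"

lemma expansion_exists1:
  assumes "degree \<phi> > 0"
  shows "\<exists>!F. is_expansion \<phi> f F"
proof (rule ex_ex1I)
  show "\<exists>F. is_expansion \<phi> f F"
  proof (induction "degree f" arbitrary: f rule: less_induct)
    case less
    show ?case
    proof (cases "degree f < degree \<phi>")
      case True
      then have "is_expansion \<phi> f [:f:]"
        using assms by (auto simp: is_expansion_def coeff_pCons split: nat.split)
      then show ?thesis ..
    next
      case False
      have "degree (f div \<phi>) < degree f"
        using False assms by (intro degree_div_less) auto
      from less[OF this] obtain F where F: "is_expansion \<phi> (f div \<phi>) F" ..
      have "degree (f mod \<phi>) < degree \<phi>"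
        using assms by (metis degree_mod_less degree_0 not_gr_zero)
      then have "is_expansion \<phi> f (pCons (f mod \<phi>) F)"
        using F by (auto simp: is_expansion_def coeff_pCons mod_mult_div_eq split: nat.split)
      then show ?thesis ..
    qed
  qed
next
  fix F G
  assume "is_expansion \<phi> f F" "is_expansion \<phi> f G"
  then show "F = G"
  proof (induction F arbitrary: f G)
    case 0
    then show ?case
    proof (induction G arbitrary: f)
      case 0
      then show ?case by simp
    next
      case (pCons b G)
      have b: "degree b < degree \<phi>" and G: "\<And>i. degree (coeff G i) < degree \<phi>"
        using pCons.prems(2) unfolding is_expansion_def
        by (metis coeff_pCons_0) (metis coeff_pCons_Suc pCons.prems(2) is_expansion_def)
      have eq: "b + \<phi> * poly G \<phi> = 0"
        using pCons.prems by (simp add: is_expansion_def)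
      have "poly G \<phi> = 0"
      proof (rule ccontr)
        assume ne: "poly G \<phi> \<noteq> 0"
        then have "degree (\<phi> * poly G \<phi>) \<ge> degree \<phi>"
          using assms by (subst degree_mult_eq) auto
        moreover have "b = - (\<phi> * poly G \<phi>)"
          using eq by (simp add: eq_neg_iff_add_eq_0)
        ultimately show False using b by simp
      qed
      with eq have "b = 0" by simp
      moreover have "0 = G"
        by (rule pCons.IH[of 0]) (use \<open>poly G \<phi> = 0\<close> G assms in \<open>auto simp: is_expansion_def\<close>)
      ultimately show ?case using pCons.hyps by simp
    qed
  next
    case (pCons a F)
    obtain b H where G_eq: "G = pCons b H" by (cases G)
    have a: "degree a < degree \<phi>" and F: "\<And>i. degree (coeff F i) < degree \<phi>"
      using pCons.prems(1) unfolding is_expansion_def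
      by (metis coeff_pCons_0) (metis coeff_pCons_Suc pCons.prems(1) is_expansion_def)
    have b: "degree b < degree \<phi>" and H: "\<And>i. degree (coeff H i) < degree \<phi>"
      using pCons.prems(2) unfolding is_expansion_def G_eq
      by (metis coeff_pCons_0) (metis coeff_pCons_Suc pCons.prems(2) G_eq is_expansion_def)
    have f1: "f = a + \<phi> * poly F \<phi>" and f2: "f = b + \<phi> * poly H \<phi>"
      using pCons.prems by (simp_all add: is_expansion_def G_eq)
    have "a = f mod \<phi>" unfolding f1 using a by (simp add: mod_poly_less)
    moreover have "b = f mod \<phi>" unfolding f2 using b by (simp add: mod_poly_less)
    ultimately have ab: "a = b" by simp
    have "poly F \<phi> = poly H \<phi>" using f1 f2 ab assms by auto
    then have "F = H"
      using F H by (intro pCons.IH[of "poly F \<phi>"]) (auto simp: is_expansion_def)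
    with ab G_eq show ?case by simp
  qed
qed

text \<open>
  The map \<open>f \<mapsto> min\<^sub>i (\<rho>(f\<^sub>i) + i\<gamma>)\<close>. Indices beyond \<open>degree (expansion \<phi> f)\<close> have \<open>f\<^sub>i = 0\<close>.
\<close>

definition augment ::
    "('k::field, 'g::linordered_ab_group_add) pmap \<Rightarrow> 'k poly \<Rightarrow> 'g infty \<Rightarrow> ('k, 'g) pmap" where
  "augment \<rho> \<phi> \<gamma> f =
     Min ((\<lambda>i. \<rho> (coeff (expansion \<phi> f) i) + nat_mult i \<gamma>) ` {..degree (expansion \<phi> f)})"

definition ordinary_augmentation ::
    "('k::field, 'g::linordered_ab_group_add) pmap \<Rightarrow> 'k poly \<Rightarrow> 'g infty \<Rightarrow> ('k, 'g) pmap \<Rightarrow> bool" where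
  "ordinary_augmentation \<mu> \<phi> \<gamma> \<nu> \<longleftrightarrow> \<phi> \<in> KP \<mu> \<and> \<mu> \<phi> < \<gamma> \<and> \<nu> = augment \<mu> \<phi> \<gamma>"

text \<open>
  The valuation \<open>\<Sum>\<^sub>i c\<^sub>i (x - \<alpha>)\<^sup>i \<mapsto> min\<^sub>i (v(c\<^sub>i) + i\<gamma>)\<close>: the coefficients of the
  \<open>(x - \<alpha>)\<close>-expansion are constant polynomials, on which \<open>\<lambda>c. v (coeff c 0)\<close> is \<open>v\<close>.
\<close>

definition depth_zero ::
    "('k::field \<Rightarrow> 'g::linordered_ab_group_add infty) \<Rightarrow> 'k \<Rightarrow> 'g infty \<Rightarrow> ('k, 'g) pmap" where
  "depth_zero v \<alpha> \<gamma> = augment (\<lambda>c. v (coeff c 0)) [:- \<alpha>, 1:] \<gamma>"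


section \<open>Continuous families and limit augmentations\<close>

text \<open>
  A family is given by a relation \<open>r\<close>, which orders the index set \<open>Field r\<close>, and a map \<open>\<rho>\<close>
  on the indices.
\<close>

definition eventually_equal :: "'i rel \<Rightarrow> ('i \<Rightarrow> 'b) \<Rightarrow> 'b \<Rightarrow> bool" where
  "eventually_equal r g c \<longleftrightarrow> (\<exists>i\<^sub>0\<in>Field r. \<forall>i. (i\<^sub>0, i) \<in> r \<longrightarrow> g i = c)"

definition eventual_value :: "'i rel \<Rightarrow> ('i \<Rightarrow> 'b) \<Rightarrow> 'b" where
  "eventual_value r g = (THE c. eventually_equal r g c)"

definition continuous_family ::
    "('k::field \<Rightarrow> 'g::linordered_ab_group_add infty) \<Rightarrow> 'i rel \<Rightarrow> ('i \<Rightarrow> ('k, 'g) pmap) \<Rightarrow> bool" where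
  "continuous_family v r \<rho> \<longleftrightarrow>
     Well_order r \<and> Field r \<noteq> {} \<and> (\<forall>i\<in>Field r. \<exists>j. (i, j) \<in> r \<and> j \<noteq> i) \<and>
     (\<forall>i\<in>Field r. poly_valuation v (\<rho> i)) \<and>
     (\<forall>i\<in>Field r. \<forall>j\<in>Field r. (i, j) \<in> r \<longleftrightarrow> \<rho> i \<le> \<rho> j) \<and>
     (\<exists>d. eventually_equal r (\<lambda>i. val_degree (\<rho> i)) d)"

definition family_degree ::
    "'i rel \<Rightarrow> ('i \<Rightarrow> ('k::field, 'g::linordered_ab_group_add) pmap) \<Rightarrow> nat" where
  "family_degree r \<rho> = eventual_value r (\<lambda>i. val_degree (\<rho> i))"

definition continuous_augmentations ::
    "('k::field \<Rightarrow> 'g::linordered_ab_group_add infty) \<Rightarrow> ('k, 'g) pmap \<Rightarrow>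
      'i rel \<Rightarrow> ('i \<Rightarrow> ('k, 'g) pmap) \<Rightarrow> bool" where
  "continuous_augmentations v \<mu> r \<rho> \<longleftrightarrow>
     continuous_family v r \<rho> \<and>
     (\<forall>i\<in>Field r. \<exists>\<chi> \<beta>. ordinary_augmentation \<mu> \<chi> \<beta> (\<rho> i))"

definition stable ::
    "'i rel \<Rightarrow> ('i \<Rightarrow> ('k::field, 'g::linordered_ab_group_add) pmap) \<Rightarrow> 'k poly \<Rightarrow> bool" where
  "stable r \<rho> f \<longleftrightarrow> (\<exists>c. eventually_equal r (\<lambda>i. \<rho> i f) c)"

definition stable_limit ::
    "'i rel \<Rightarrow> ('i \<Rightarrow> ('k::field, 'g::linordered_ab_group_add) pmap) \<Rightarrow> ('k, 'g) pmap" where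
  "stable_limit r \<rho> f = eventual_value r (\<lambda>i. \<rho> i f)"

definition unstable_degree ::
    "'i rel \<Rightarrow> ('i \<Rightarrow> ('k::field, 'g::linordered_ab_group_add) pmap) \<Rightarrow> enat" where
  "unstable_degree r \<rho> = Inf {enat (degree f) | f. \<not> stable r \<rho> f}"

definition essential ::
    "'i rel \<Rightarrow> ('i \<Rightarrow> ('k::field, 'g::linordered_ab_group_add) pmap) \<Rightarrow> bool" where
  "essential r \<rho> \<longleftrightarrow> enat (family_degree r \<rho>) < unstable_degree r \<rho> \<and> unstable_degree r \<rho> < \<infinity>"

definition limit_KP ::
    "'i rel \<Rightarrow> ('i \<Rightarrow> ('k::field, 'g::linordered_ab_group_add) pmap) \<Rightarrow> 'k poly set" where
  "limit_KP r \<rho> =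
     {\<phi>. lead_coeff \<phi> = 1 \<and> \<not> stable r \<rho> \<phi> \<and> enat (degree \<phi>) = unstable_degree r \<rho>}"

definition limit_augmentation ::
    "'i rel \<Rightarrow> ('i \<Rightarrow> ('k::field, 'g::linordered_ab_group_add) pmap) \<Rightarrow>
      'k poly \<Rightarrow> 'g infty \<Rightarrow> ('k, 'g) pmap \<Rightarrow> bool" where
  "limit_augmentation r \<rho> \<phi> \<gamma> \<nu> \<longleftrightarrow>
     \<phi> \<in> limit_KP r \<rho> \<and> (\<forall>i\<in>Field r. \<rho> i \<phi> < \<gamma>) \<and> \<nu> = augment (stable_limit r \<rho>) \<phi> \<gamma>"


section \<open>Mac Lane--Vaquie chains\<close>

text \<open>
  The type variable \<open>'i\<close> is the type of the indices of the continuous families. The entries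
  \<open>val n\<close>, \<open>kpoly n\<close>, \<open>kval n\<close> are \<open>\<mu>\<^sub>n\<close>, \<open>\<phi>\<^sub>n\<close>, \<open>\<gamma>\<^sub>n\<close> for \<open>n \<le> num_steps\<close>, and
  \<open>nature n\<close> describes the step from \<open>\<mu>\<^sub>n\<close> to \<open>\<mu>\<^sub>n\<^sub>+\<^sub>1\<close> for \<open>n < num_steps\<close>; all other
  entries are irrelevant.
\<close>

datatype ('i, 'w) step_nature =
    Ordinary
  | Limit "'i rel" "'i \<Rightarrow> 'w"

record (overloaded) ('k::zero, 'g, 'i) chain =
  num_steps :: enat
  val :: "nat \<Rightarrow> ('k, 'g) pmap"
  kpoly :: "nat \<Rightarrow> 'k poly"
  kval :: "nat \<Rightarrow> 'g infty"
  nature :: "nat \<Rightarrow> ('i, ('k, 'g) pmap) step_nature"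

definition mlv_step ::
    "('k::field \<Rightarrow> 'g::linordered_ab_group_add infty) \<Rightarrow> ('k, 'g, 'i) chain \<Rightarrow> nat \<Rightarrow> bool" where
  "mlv_step v C n \<longleftrightarrow>
     (let \<mu> = val C n; \<nu> = val C (Suc n); \<phi> = kpoly C (Suc n); \<gamma> = kval C (Suc n) in
      case nature C n of
        Ordinary \<Rightarrow>
          ordinary_augmentation \<mu> \<phi> \<gamma> \<nu> \<and>
          val_degree \<mu> < tangent_degree \<mu> \<nu>
      | Limit r \<rho> \<Rightarrow>
          continuous_augmentations v \<mu> r \<rho> \<and>
          essential r \<rho> \<and>
          limit_augmentation r \<rho> \<phi> \<gamma> \<nu> \<and>
          val_degree \<mu> = tangent_degree \<mu> \<nu> \<and>
          tangent_degree \<mu> \<nu> < val_degree \<nu> \<and>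
          kpoly C n \<notin> tangent_direction \<mu> \<nu>)"

definition mlv_chain ::
    "('k::field \<Rightarrow> 'g::linordered_ab_group_add infty) \<Rightarrow> ('k, 'g, 'i) chain \<Rightarrow> bool" where
  "mlv_chain v C \<longleftrightarrow>
     (\<exists>\<alpha>. kpoly C 0 = [:- \<alpha>, 1:] \<and> val C 0 = depth_zero v \<alpha> (kval C 0)) \<and>
     (\<forall>n. enat n < num_steps C \<longrightarrow> mlv_step v C n)"

definition chain_type1 ::
    "('k::field, 'g::linordered_ab_group_add, 'i) chain \<Rightarrow> ('k, 'g) pmap \<Rightarrow> bool" where
  "chain_type1 C \<mu> \<longleftrightarrow> (\<exists>n. num_steps C = enat n \<and> val C n = \<mu>)"

definition chain_type2 ::
    "('k::field \<Rightarrow> 'g::linordered_ab_group_add infty) \<Rightarrow>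
      ('k, 'g, 'i) chain \<Rightarrow> ('k, 'g) pmap \<Rightarrow> bool" where
  "chain_type2 v C \<mu> \<longleftrightarrow>
     (\<exists>n (r :: 'i rel) \<rho>.
        num_steps C = enat n \<and>
        continuous_augmentations v (val C n) r \<rho> \<and>
        (\<forall>f. stable r \<rho> f) \<and> \<mu> = stable_limit r \<rho> \<and>
        tangent_degree (val C n) \<mu> = val_degree (val C n) \<and>
        kpoly C n \<notin> tangent_direction (val C n) \<mu>)"

definition chain_type3 ::
    "('k::field, 'g::linordered_ab_group_add, 'i) chain \<Rightarrow> ('k, 'g) pmap \<Rightarrow> bool" where
  "chain_type3 C \<mu> \<longleftrightarrow> num_steps C = \<infinity> \<and> (\<forall>f. \<exists>N. \<forall>n\<ge>N. val C n f = \<mu> f)"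

definition mlv_chain_of ::
    "('k::field \<Rightarrow> 'g::linordered_ab_group_add infty) \<Rightarrow>
      ('k, 'g, 'i) chain \<Rightarrow> ('k, 'g) pmap \<Rightarrow> bool" where
  "mlv_chain_of v C \<mu> \<longleftrightarrow>
     mlv_chain v C \<and> (chain_type1 C \<mu> \<or> chain_type2 v C \<mu> \<or> chain_type3 C \<mu>)"


section \<open>The defect of an augmentation\<close>

text \<open>
  The degree \<open>deg\<^sub>\<rho>(f)\<close> with respect to the \<open>Q\<close>-expansion of \<open>f\<close>. The bound on \<open>i\<close> only
  matters if \<open>\<rho>(f) = \<infinity>\<close>: it excludes the indices beyond the last nonzero coefficient.
\<close>

definition expansion_degree ::
    "('k::field, 'g::linordered_ab_group_add) pmap \<Rightarrow> 'k poly \<Rightarrow> 'k poly \<Rightarrow> nat" where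
  "expansion_degree \<rho> Q f =
     Max {i. i \<le> degree (expansion Q f) \<and> \<rho> (coeff (expansion Q f) i * Q ^ i) = \<rho> f}"

definition minimal_polys :: "('k::field, 'g::linordered_ab_group_add) pmap \<Rightarrow> 'k poly set" where
  "minimal_polys \<nu> =
     (if support \<nu> = {0} then {\<phi> \<in> KP \<nu>. degree \<phi> = val_degree \<nu>} else support_generators \<nu>)"

text \<open>The choice of \<open>\<phi>\<close> is immaterial.\<close>

definition defect ::
    "('k::field, 'g::linordered_ab_group_add) pmap \<Rightarrow> ('k, 'g) pmap \<Rightarrow> nat" where
  "defect \<mu> \<nu> =
     (let \<phi> = (SOME \<phi>. \<phi> \<in> minimal_polys \<nu>) in
      LEAST d. \<exists>Q\<in>tangent_direction \<mu> \<nu>. d = expansion_degree (augment \<mu> Q (\<nu> Q)) Q \<phi>)"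

end

theory Submission
  imports Defs
begin

text \<open>
  The defect of a step can be read off from the limit \<open>\<mu>\<close> of the chain alone. Write
  \<open>m = deg \<phi>\<^sub>n\<close>. From the index \<open>n\<close> on, no valuation of the chain changes below degree \<open>m\<close>,
  so \<open>\<mu>\<^sub>n\<close> agrees with \<open>\<mu>\<close> there. A valuation that is computed from \<open>\<mu>\<^sub>n\<close> and the value \<open>\<mu>(Q)\<close> by
  expansions \<open>f = \<Sum>\<^sub>i f\<^sub>i Q\<^sup>i\<close> in a monic polynomial \<open>Q\<close> of degree \<open>m\<close> is therefore the truncation
  \<open>\<mu>\<^sub>Q(f) = min\<^sub>i (\<mu>(f\<^sub>i) + i\<mu>(Q))\<close>, in which only \<open>\<mu>\<close> and \<open>Q\<close> occur. Moreover, \<open>\<mu>\<^sub>Q \<le> \<mu>\<^sub>P\<close>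
  whenever \<open>\<mu>(Q) \<le> \<mu>(P)\<close> and \<open>\<mu>\<^sub>P\<close> is a valuation. What matters is how the values \<open>\<mu>(Q)\<close>, for
  \<open>Q\<close> monic of degree \<open>m\<close>, are distributed.

  In an ordinary step \<open>\<mu>(\<phi>\<^sub>n)\<close> is the largest of these values and \<open>\<mu>\<^sub>n\<close> is the truncation at
  \<open>\<phi>\<^sub>n\<close>. Two polynomials of this largest value would have the same truncation. So \<open>\<mu>\<^sub>n\<close> is determined
  by \<open>\<mu>\<close> and \<open>m\<close>, and so is \<open>deg \<phi>\<^sub>n\<^sub>+\<^sub>1\<close>, the least degree in which \<open>\<mu>\<^sub>n\<close> and \<open>\<mu>\<close> differ. The
  defect is always 1, because the polynomials of the tangent direction have the same degree
  as the minimal polynomials of \<open>\<mu>\<^sub>n\<^sub>+\<^sub>1\<close>.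

  In a limit step the values \<open>\<mu>(Q)\<close> have no maximum; so the nature of the step is determined by
  \<open>\<mu>\<close> and \<open>m\<close> as well. The tangent direction consists of all \<open>Q\<close> with \<open>\<mu>(Q) > \<mu>(\<phi>\<^sub>n)\<close>, and the
  auxiliary valuations in the definition of the defect are the \<open>\<mu>\<^sub>Q\<close>. Two chains
  can have different bounds \<open>\<mu>(\<phi>\<^sub>n)\<close>, but one of the two tangent directions is then a final segment
  of the other. The next degree is the least degree of a polynomial \<open>f\<close> such that no truncation
  in such a segment takes the value \<open>\<mu>(f)\<close> at \<open>f\<close>, which does not depend on the segment. For the
  defect two facts are needed. First, \<open>deg\<^bsub>\<mu>\<^sub>Q\<^esub>(f)\<close> does not increase if \<open>\<mu>(Q)\<close> increases
  (\<open>expansion_degree_antimono\<close>), so the minimum can be computed in any final segment. Second, if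
  \<open>\<phi>\<close> and \<open>\<phi>'\<close> are minimal polynomials of the valuations reached by the two chains, then the
  truncations of \<open>a = \<phi>' - \<phi>\<close> become constant, whereas those of \<open>\<phi>\<close> and \<open>\<phi>'\<close> go on growing. This
  forces \<open>\<mu>\<^sub>Q(\<phi>) < \<mu>\<^sub>Q(a)\<close> for large \<open>\<mu>(Q)\<close>, and then \<open>deg\<^bsub>\<mu>\<^sub>Q\<^esub>(\<phi>) = deg\<^bsub>\<mu>\<^sub>Q\<^esub>(\<phi>')\<close>
  (\<open>limit_direction_expansion_degree_le\<close>).

  Induction on \<open>n\<close> now shows that \<open>deg \<phi>\<^sub>n\<close> is the same for both chains. All this presupposes
  that ordinary and limit augmentations are valuations. Both follow from one criterion on the
  products of polynomials of small degree, \<open>augmentable\<close>.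
\<close>

section \<open>Arithmetic with an adjoined infinity\<close>

lemma infty_simps [simp]:
  fixes x :: "'g::linordered_ab_group_add infty"
  shows "x \<le> Infty" "Infty \<le> x \<longleftrightarrow> x = Infty" "\<not> Infty < x" "x < Infty \<longleftrightarrow> x \<noteq> Infty"
    "Infty + x = Infty" "x + Infty = Infty"
  by (cases x; simp add: less_eq_infty_def less_infty_def plus_infty_def)+

lemma Fin_simps [simp]:
  fixes x y :: "'g::linordered_ab_group_add"
  shows "Fin x \<le> Fin y \<longleftrightarrow> x \<le> y" "Fin x < Fin y \<longleftrightarrow> x < y" "Fin x + Fin y = Fin (x + y)"
    "Fin x = 0 \<longleftrightarrow> x = 0" "0 \<noteq> (Infty :: 'g infty)" "Infty \<noteq> (0 :: 'g infty)"
  by (auto simp: less_eq_infty_def less_infty_def plus_infty_def zero_infty_def)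

instance infty :: (linordered_ab_group_add) ordered_comm_monoid_add
proof
  fix a b c :: "'a infty"
  assume "a \<le> b" then show "c + a \<le> c + b"
    by (cases a; cases b; cases c) simp_all
qed

lemma add_eq_Infty [simp]:
  fixes x y :: "'g::linordered_ab_group_add infty"
  shows "x + y = Infty \<longleftrightarrow> x = Infty \<or> y = Infty"
  by (cases x; cases y) simp_all

lemma infty_cancel [simp]:
  fixes a b c :: "'g::linordered_ab_group_add infty"
  assumes "a \<noteq> Infty"
  shows "a + b \<le> a + c \<longleftrightarrow> b \<le> c" "a + b < a + c \<longleftrightarrow> b < c" "a + b = a + c \<longleftrightarrow> b = c"
    "b + a \<le> c + a \<longleftrightarrow> b \<le> c" "b + a < c + a \<longleftrightarrow> b < c" "b + a = c + a \<longleftrightarrow> b = c"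
  using assms by (cases a; cases b; cases c; simp)+

lemma infty_add_less_le_mono:
  fixes a b c d :: "'g::linordered_ab_group_add infty"
  assumes "a < c" "b \<le> d" "b \<noteq> Infty"
  shows "a + b < c + d"
  using assms by (cases a; cases b; cases c; cases d) (simp_all add: add_less_le_mono)

lemma infty_add_min:
  fixes a b c :: "'g::linordered_ab_group_add infty"
  shows "a + min b c = min (a + b) (a + c)"
  by (cases a; cases b; cases c) (simp_all add: min_def)

lemma nat_mult_simps [simp]:
  "nat_mult 0 \<gamma> = 0" "nat_mult (Suc i) \<gamma> = \<gamma> + nat_mult i \<gamma>"
  by (simp_all add: nat_mult_def ac_simps)

lemma nat_mult_add: "nat_mult (i + j) \<gamma> = nat_mult i \<gamma> + nat_mult j \<gamma>"
  by (induction i) (simp_all add: add.assoc)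

lemma nat_mult_eq_Infty [simp]:
  fixes \<gamma> :: "'g::linordered_ab_group_add infty"
  assumes "\<gamma> \<noteq> Infty"
  shows "nat_mult i \<gamma> \<noteq> Infty"
  using assms by (induction i) auto

lemma nat_mult_mono:
  fixes \<gamma> :: "'g::linordered_ab_group_add infty"
  shows "\<gamma> \<le> \<delta> \<Longrightarrow> nat_mult i \<gamma> \<le> nat_mult i \<delta>"
  by (induction i) (auto intro: add_mono)


section \<open>Valuations on polynomials\<close>

locale valuation =
  fixes v :: "'k::field \<Rightarrow> 'g::linordered_ab_group_add infty" and \<mu> :: "('k, 'g) pmap"
  assumes field_val: "field_valuation v" and poly_val: "poly_valuation v \<mu>"
begin

lemma const [simp]: "\<mu> [:c:] = v c"
  and mult [simp]: "\<mu> (f * g) = \<mu> f + \<mu> g"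
  and add_ge: "min (\<mu> f) (\<mu> g) \<le> \<mu> (f + g)"
  using poly_val by (simp_all add: poly_valuation_def)

lemma zero [simp]: "\<mu> 0 = Infty"
  using const[of 0] field_val by (simp add: field_valuation_def)

lemma one [simp]: "\<mu> 1 = 0"
proof -
  have "\<mu> 1 \<noteq> Infty"
    using field_val const[of 1] by (simp add: field_valuation_def one_pCons)
  moreover have "\<mu> 1 = \<mu> 1 + \<mu> 1" using mult[of 1 1] by simp
  ultimately show ?thesis by (cases "\<mu> 1") (auto simp: zero_infty_def)
qed

lemma uminus [simp]: "\<mu> (- f) = \<mu> f"
proof -
  have "\<mu> (- 1) + \<mu> (- 1) = 0" using mult[of "-1" "-1"] by simp
  then have "\<mu> (- 1) = 0" by (cases "\<mu> (- 1)") auto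
  then show ?thesis using mult[of "-1" f] by simp
qed

lemma diff_ge: "min (\<mu> f) (\<mu> g) \<le> \<mu> (f - g)"
  using add_ge[of f "- g"] by simp

lemma minus_commute: "\<mu> (f - g) = \<mu> (g - f)"
  using uminus[of "f - g"] by simp

lemma ge_add: "c \<le> \<mu> f \<Longrightarrow> c \<le> \<mu> g \<Longrightarrow> c \<le> \<mu> (f + g)"
  and ge_diff: "c \<le> \<mu> f \<Longrightarrow> c \<le> \<mu> g \<Longrightarrow> c \<le> \<mu> (f - g)"
  and gt_add: "c < \<mu> f \<Longrightarrow> c < \<mu> g \<Longrightarrow> c < \<mu> (f + g)"
  using add_ge[of f g] diff_ge[of f g] by (auto simp: min_def split: if_splits)

lemma add_eq: "\<mu> f < \<mu> g \<Longrightarrow> \<mu> (f + g) = \<mu> f"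
  using add_ge[of f g] diff_ge[of "f + g" g] by (auto simp: min_def split: if_splits)

lemma diff_eq: "\<mu> f < \<mu> g \<Longrightarrow> \<mu> (f - g) = \<mu> f"
  using add_eq[of f "- g"] by simp

lemma smult [simp]: "\<mu> (smult c f) = v c + \<mu> f"
  using mult[of "[:c:]" f] by simp

lemma v_eq_Infty [simp]: "v c = Infty \<longleftrightarrow> c = 0"
  using field_val by (simp add: field_valuation_def)

lemma power [simp]: "\<mu> (f ^ i) = nat_mult i (\<mu> f)"
  by (induction i) auto

lemma val_equiv_iff: "val_equiv \<mu> f g \<longleftrightarrow> \<mu> f < \<mu> (f - g)"
  using diff_eq[of f "f - g"] by (auto simp: val_equiv_def)

lemma val_dvd_iff: "val_dvd \<mu> f g \<longleftrightarrow> (\<exists>h. \<mu> g < \<mu> (g - f * h))"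
  by (simp add: val_dvd_def val_equiv_iff)

end

lemma monic_degree_0:
  assumes "lead_coeff f = 1" "degree f = 0" shows "f = (1 :: 'k::field poly)"
  using assms by (metis degree_0_id of_nat_1 one_pCons)

lemma monic_diff_degree:
  fixes f g :: "'k::field poly"
  assumes "lead_coeff f = 1" "lead_coeff g = 1" "degree f = degree g" "degree f > 0"
  shows "degree (f - g) < degree f"
proof (rule degree_lessI)
  show "\<forall>k\<ge>degree f. coeff (f - g) k = 0"
  proof (intro allI impI)
    fix k assume "k \<ge> degree f"
    then show "coeff (f - g) k = 0"
      using assms by (cases "k = degree f") (auto simp: coeff_eq_0)
  qed
qed (use assms in auto)


section \<open>Expansions and augmentations\<close>

lemma expansionI: "degree \<phi> > 0 \<Longrightarrow> is_expansion \<phi> f F \<Longrightarrow> expansion \<phi> f = F"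
  unfolding expansion_def by (rule the1_equality[OF expansion_exists1])

lemma is_expansion_expansion: "degree \<phi> > 0 \<Longrightarrow> is_expansion \<phi> f (expansion \<phi> f)"
  unfolding expansion_def by (rule theI'[OF expansion_exists1])

lemma expansion_0 [simp]: "degree \<phi> > 0 \<Longrightarrow> expansion \<phi> 0 = 0"
  by (rule expansionI) (auto simp: is_expansion_def)

lemma degree_mod_lt: "degree \<phi> > 0 \<Longrightarrow> degree (f mod \<phi>) < degree (\<phi> :: 'k::field poly)"
  by (metis degree_0 degree_mod_less not_gr_zero)

lemma expansion_rec:
  assumes "degree \<phi> > 0"
  shows "expansion \<phi> f = pCons (f mod \<phi>) (expansion \<phi> (f div \<phi>))"
  using is_expansion_expansion[OF assms, of "f div \<phi>"] degree_mod_lt[OF assms, of f] assms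
  by (intro expansionI) (auto simp: is_expansion_def coeff_pCons mod_mult_div_eq split: nat.split)

lemma expansion_add:
  assumes "degree \<phi> > 0"
  shows "expansion \<phi> (f + g) = expansion \<phi> f + expansion \<phi> g"
  using is_expansion_expansion[OF assms, of f] is_expansion_expansion[OF assms, of g] assms
  by (intro expansionI) (auto simp: is_expansion_def intro: degree_add_less)

lemma coeff_expansion_less: "degree \<phi> > 0 \<Longrightarrow> degree (coeff (expansion \<phi> f) i) < degree \<phi>"
  using is_expansion_expansion by (auto simp: is_expansion_def)

lemma degree_div_lt:
  fixes f \<phi> :: "'k::field poly"
  assumes "degree \<phi> > 0" "degree f > 0" shows "degree (f div \<phi>) < degree f"
  using assms by (cases "degree f < degree \<phi>") (auto simp: div_poly_less intro: degree_div_less)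

lemma degree_div_add:
  fixes f \<phi> :: "'k::field poly"
  assumes "degree \<phi> > 0" "f div \<phi> \<noteq> 0"
  shows "degree (f div \<phi>) + degree \<phi> = degree f"
proof -
  have p: "degree (f div \<phi> * \<phi>) = degree (f div \<phi>) + degree \<phi>"
    using assms by (intro degree_mult_eq) auto
  then have "degree (f div \<phi> * \<phi> + f mod \<phi>) = degree (f div \<phi> * \<phi>)"
    using degree_mod_lt[OF assms(1), of f] by (intro degree_add_eq_left) simp
  then show ?thesis using p by simp
qed

text \<open>The induction that fits Horner's scheme: from the quotient by \<open>\<phi>\<close> to the dividend.\<close>

lemma div_induct [consumes 1, case_names zero step]:
  fixes \<phi> :: "'k::field poly"
  assumes "degree \<phi> > 0" and z: "P 0" and s: "\<And>f. f \<noteq> 0 \<Longrightarrow> P (f div \<phi>) \<Longrightarrow> P f"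
  shows "P f"
proof (induction "degree f" arbitrary: f rule: less_induct)
  case less
  show ?case
  proof (cases "degree f = 0")
    case True
    then have "f div \<phi> = 0" using assms(1) by (simp add: div_poly_less)
    then show ?thesis using z s[of f] by (cases "f = 0") simp_all
  next
    case False
    then have "P (f div \<phi>)" using less degree_div_lt[OF assms(1), of f] by blast
    moreover have "f \<noteq> 0" using False by auto
    ultimately show ?thesis by (rule s[rotated])
  qed
qed

lemma coeff_expansion_div_power:
  assumes "degree \<phi> > 0"
  shows "coeff (expansion \<phi> (f div \<phi> ^ k)) i = coeff (expansion \<phi> f) (i + k)"
proof (induction k arbitrary: i)
  case (Suc k)
  have "f div \<phi> ^ Suc k = (f div \<phi> ^ k) div \<phi>"
    unfolding power_Suc2 by (rule poly_div_mult_right)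
  then have "coeff (expansion \<phi> (f div \<phi> ^ Suc k)) i = coeff (expansion \<phi> (f div \<phi> ^ k)) (Suc i)"
    by (simp add: expansion_rec[OF assms, of "f div \<phi> ^ k"])
  then show ?case by (simp add: Suc)
qed simp

lemma coeff_expansion_eq_0:
  assumes "degree \<phi> > 0" "degree f < k * degree \<phi>" "k \<le> i"
  shows "coeff (expansion \<phi> f) i = 0"
proof -
  have "\<phi> \<noteq> 0" using assms(1) by auto
  moreover have "degree f < i * degree \<phi>" using assms(2,3) by (meson less_le_trans mult_le_mono1)
  ultimately have "f div \<phi> ^ i = 0" by (intro div_poly_less) (simp add: degree_power_eq)
  then show ?thesis using coeff_expansion_div_power[OF assms(1), of f i 0] assms(1) by simp
qed

lemma augment_0 [simp]: "degree \<phi> > 0 \<Longrightarrow> augment \<rho> \<phi> \<gamma> 0 = \<rho> 0"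
  by (simp add: augment_def)

lemma augment_le:
  fixes \<rho> :: "('k::field, 'g::linordered_ab_group_add) pmap"
  assumes "\<rho> 0 = Infty"
  shows "augment \<rho> \<phi> \<gamma> f \<le> \<rho> (coeff (expansion \<phi> f) i) + nat_mult i \<gamma>"
proof (cases "i \<le> degree (expansion \<phi> f)")
  case False then show ?thesis using assms by (simp add: coeff_eq_0)
qed (auto simp: augment_def intro: Min_le)

lemma augment_attained:
  obtains i where "i \<le> degree (expansion \<phi> f)"
    "augment \<rho> \<phi> \<gamma> f = \<rho> (coeff (expansion \<phi> f) i) + nat_mult i \<gamma>"
proof -
  have "augment \<rho> \<phi> \<gamma> f \<in> (\<lambda>i. \<rho> (coeff (expansion \<phi> f) i) + nat_mult i \<gamma>) ` {..degree (expansion \<phi> f)}"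
    unfolding augment_def by (rule Min_in) auto
  then show ?thesis using that by auto
qed

text \<open>Horner's scheme.\<close>

lemma augment_rec:
  fixes \<rho> :: "('k::field, 'g::linordered_ab_group_add) pmap"
  assumes "degree \<phi> > 0" "\<rho> 0 = Infty"
  shows "augment \<rho> \<phi> \<gamma> f = min (\<rho> (f mod \<phi>)) (\<gamma> + augment \<rho> \<phi> \<gamma> (f div \<phi>))"
proof (rule antisym)
  note r = expansion_rec[OF assms(1), of f]
  obtain i where i: "augment \<rho> \<phi> \<gamma> (f div \<phi>) =
      \<rho> (coeff (expansion \<phi> (f div \<phi>)) i) + nat_mult i \<gamma>" by (rule augment_attained)
  show "augment \<rho> \<phi> \<gamma> f \<le> min (\<rho> (f mod \<phi>)) (\<gamma> + augment \<rho> \<phi> \<gamma> (f div \<phi>))"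
    using augment_le[of \<rho> \<phi> \<gamma> f 0] augment_le[of \<rho> \<phi> \<gamma> f "Suc i"] assms i r
    by (auto simp: add.left_commute)
  obtain j where j: "augment \<rho> \<phi> \<gamma> f = \<rho> (coeff (expansion \<phi> f) j) + nat_mult j \<gamma>"
    by (rule augment_attained)
  show "min (\<rho> (f mod \<phi>)) (\<gamma> + augment \<rho> \<phi> \<gamma> (f div \<phi>)) \<le> augment \<rho> \<phi> \<gamma> f"
  proof (cases j)
    case 0 then show ?thesis using j r by auto
  next
    case (Suc k)
    have "augment \<rho> \<phi> \<gamma> (f div \<phi>) \<le> \<rho> (coeff (expansion \<phi> (f div \<phi>)) k) + nat_mult k \<gamma>"
      using assms by (intro augment_le)
    then have "\<gamma> + augment \<rho> \<phi> \<gamma> (f div \<phi>) \<le> augment \<rho> \<phi> \<gamma> f"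
      using j r Suc by (simp add: add.left_commute add_left_mono)
    then show ?thesis by (simp add: min.coboundedI2)
  qed
qed

lemma augment_low:
  fixes \<rho> :: "('k::field, 'g::linordered_ab_group_add) pmap"
  assumes "degree f < degree \<phi>" "\<rho> 0 = Infty"
  shows "augment \<rho> \<phi> \<gamma> f = \<rho> f"
  using augment_rec[of \<phi> \<rho> \<gamma> f] assms by (simp add: mod_poly_less div_poly_less)

lemma augment_mult_key:
  fixes \<rho> :: "('k::field, 'g::linordered_ab_group_add) pmap"
  assumes "degree \<phi> > 0" "\<rho> 0 = Infty"
  shows "augment \<rho> \<phi> \<gamma> (\<phi> * f) = \<gamma> + augment \<rho> \<phi> \<gamma> f"
  using augment_rec[of \<phi> \<rho> \<gamma> "\<phi> * f"] assms by auto

lemma augment_cong: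
  assumes "degree \<phi> > 0" "\<And>a. degree a < degree \<phi> \<Longrightarrow> \<rho> a = \<rho>' a"
  shows "augment \<rho> \<phi> \<gamma> = augment \<rho>' \<phi> \<gamma>"
  by (rule ext) (simp add: augment_def assms coeff_expansion_less)

text \<open>
  Horner's scheme turns the two lower bounds into one for all polynomials. This comparison is used
  throughout to order valuations that come from expansions in different polynomials.
\<close>

lemma (in valuation) augment_le_valuation:
  assumes "degree \<phi> > 0" "\<rho> 0 = Infty" "\<And>a. degree a < degree \<phi> \<Longrightarrow> \<rho> a \<le> \<mu> a" "\<gamma> \<le> \<mu> \<phi>"
  shows "augment \<rho> \<phi> \<gamma> f \<le> \<mu> f"
  using assms(1)
proof (induction rule: div_induct[where f = f])
  case (step f)
  have "min (\<mu> (f mod \<phi>)) (\<mu> \<phi> + \<mu> (f div \<phi>)) \<le> \<mu> f"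
    using add_ge[of "f mod \<phi>" "\<phi> * (f div \<phi>)"] by (simp add: mod_mult_div_eq)
  moreover have "\<gamma> + augment \<rho> \<phi> \<gamma> (f div \<phi>) \<le> \<mu> \<phi> + \<mu> (f div \<phi>)"
    using step assms by (intro add_mono)
  moreover have "\<rho> (f mod \<phi>) \<le> \<mu> (f mod \<phi>)" using assms degree_mod_lt by auto
  ultimately have "min (\<rho> (f mod \<phi>)) (\<gamma> + augment \<rho> \<phi> \<gamma> (f div \<phi>)) \<le> \<mu> f"
    by (meson min.mono order_trans)
  then show ?case by (subst augment_rec) (use assms in auto)
qed (use assms in simp)


section \<open>Augmentations are valuations\<close>

text \<open>
  The last condition carries the content. It says that for small \<open>a\<close> and \<open>b\<close> the remainder of
  \<open>ab\<close> modulo \<open>\<phi>\<close> takes the value that multiplicativity prescribes for \<open>ab\<close>, and that the part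
  divisible by \<open>\<phi>\<close> has a strictly larger value once \<open>\<phi>\<close> is given the value \<open>\<gamma>\<close>. Only the values
  of \<open>\<rho>\<close> below the degree of \<open>\<phi>\<close> enter, because the stable values of a continuous family
  are defined only there.
\<close>

definition augmentable ::
    "('k::field \<Rightarrow> 'g::linordered_ab_group_add infty) \<Rightarrow> ('k, 'g) pmap \<Rightarrow> 'k poly \<Rightarrow> 'g infty \<Rightarrow> bool" where
  "augmentable v \<rho> \<phi> \<gamma> \<longleftrightarrow>
     lead_coeff \<phi> = 1 \<and> degree \<phi> > 0 \<and> (\<forall>c. \<rho> [:c:] = v c) \<and>
     (\<forall>a. degree a < degree \<phi> \<longrightarrow> \<rho> a = Infty \<longrightarrow> a = 0) \<and>
     (\<forall>a b. degree a < degree \<phi> \<longrightarrow> degree b < degree \<phi> \<longrightarrow> min (\<rho> a) (\<rho> b) \<le> \<rho> (a + b)) \<and>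
     (\<forall>a b. degree a < degree \<phi> \<longrightarrow> degree b < degree \<phi> \<longrightarrow> a \<noteq> 0 \<longrightarrow> b \<noteq> 0 \<longrightarrow>
        \<rho> (a * b mod \<phi>) = \<rho> a + \<rho> b \<and> \<rho> a + \<rho> b < \<gamma> + \<rho> (a * b div \<phi>))"

lemma degree_mult_div_less:
  fixes a b \<phi> :: "'k::field poly"
  assumes "degree a < degree \<phi>" "degree b < degree \<phi>"
  shows "degree (a * b div \<phi>) < degree \<phi>"
  using degree_div_add[of \<phi> "a * b"] degree_mult_le[of a b] assms
  by (cases "a * b div \<phi> = 0") auto

locale augmentable_at =
  fixes v :: "'k::field \<Rightarrow> 'g::linordered_ab_group_add infty"
    and \<rho> :: "('k, 'g) pmap" and \<phi> :: "'k poly" and \<gamma> :: "'g infty"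
  assumes field_val: "field_valuation v" and augmentable: "augmentable v \<rho> \<phi> \<gamma>"
begin

abbreviation "\<nu> \<equiv> augment \<rho> \<phi> \<gamma>"

lemma monic: "lead_coeff \<phi> = 1" and deg_pos: "degree \<phi> > 0"
  and base_const: "\<rho> [:c:] = v c"
  and base_finite: "degree a < degree \<phi> \<Longrightarrow> \<rho> a = Infty \<Longrightarrow> a = 0"
  and base_add: "degree a < degree \<phi> \<Longrightarrow> degree b < degree \<phi> \<Longrightarrow> min (\<rho> a) (\<rho> b) \<le> \<rho> (a + b)"
  and base_mod: "degree a < degree \<phi> \<Longrightarrow> degree b < degree \<phi> \<Longrightarrow> a \<noteq> 0 \<Longrightarrow> b \<noteq> 0 \<Longrightarrow>
        \<rho> (a * b mod \<phi>) = \<rho> a + \<rho> b"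
  and base_div: "degree a < degree \<phi> \<Longrightarrow> degree b < degree \<phi> \<Longrightarrow> a \<noteq> 0 \<Longrightarrow> b \<noteq> 0 \<Longrightarrow>
        \<rho> a + \<rho> b < \<gamma> + \<rho> (a * b div \<phi>)"
  using augmentable by (auto simp: augmentable_def)

lemma base_0 [simp]: "\<rho> 0 = Infty"
  using base_const[of 0] field_val by (simp add: field_valuation_def)

lemma nonzero: "\<phi> \<noteq> 0" using deg_pos by auto

lemma rec: "\<nu> f = min (\<rho> (f mod \<phi>)) (\<gamma> + \<nu> (f div \<phi>))"
  by (rule augment_rec) (simp_all add: deg_pos)

lemma low: "degree a < degree \<phi> \<Longrightarrow> \<nu> a = \<rho> a"
  by (rule augment_low) simp_all

lemma mod_low: "degree (f mod \<phi>) < degree \<phi>"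
  by (rule degree_mod_lt[OF deg_pos])

lemma key_mult: "\<nu> (\<phi> * f) = \<gamma> + \<nu> f"
  by (rule augment_mult_key) (simp_all add: deg_pos)

lemma key_power_mult: "\<nu> (\<phi> ^ s * f) = nat_mult s \<gamma> + \<nu> f"
  by (induction s) (simp_all add: key_mult mult.assoc add.assoc)

lemma zero: "\<nu> 0 = Infty"
  by (simp add: deg_pos)

lemma aug_add: "min (\<nu> f) (\<nu> g) \<le> \<nu> (f + g)"
proof (induction f arbitrary: g rule: div_induct[OF deg_pos])
  case 1 then show ?case by (simp add: zero)
next
  case (2 f)
  let ?a = "f mod \<phi>" and ?b = "g mod \<phi>" and ?F = "f div \<phi>" and ?G = "g div \<phi>"
  have 1: "min (\<rho> ?a) (\<rho> ?b) \<le> \<rho> (?a + ?b)" by (rule base_add) (rule mod_low)+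
  have 2: "\<gamma> + min (\<nu> ?F) (\<nu> ?G) \<le> \<gamma> + \<nu> (?F + ?G)" by (rule add_left_mono) (rule 2)
  have 3: "\<nu> (f + g) = min (\<rho> (?a + ?b)) (\<gamma> + \<nu> (?F + ?G))"
    by (subst rec) (simp add: poly_mod_add_left poly_div_add_left)
  show ?case using 1 2 unfolding 3 rec[of f] rec[of g] infty_add_min
    by (auto simp: min_le_iff_disj)
qed

lemma aug_ge_add: "c \<le> \<nu> f \<Longrightarrow> c \<le> \<nu> g \<Longrightarrow> c \<le> \<nu> (f + g)"
  using aug_add[of f g] by (auto simp: min_def split: if_splits)

lemma aug_gt_add: "c < \<nu> f \<Longrightarrow> c < \<nu> g \<Longrightarrow> c < \<nu> (f + g)"
  using aug_add[of f g] by (auto simp: min_def split: if_splits)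

lemma low_mult:
  assumes "degree a < degree \<phi>" "degree b < degree \<phi>" "a \<noteq> 0" "b \<noteq> 0"
  shows "\<nu> (a * b) = \<rho> a + \<rho> b"
  using base_mod[OF assms] base_div[OF assms] degree_mult_div_less[OF assms(1,2)]
  by (subst rec) (simp add: low)

lemma low_mult_ge:
  assumes "degree a < degree \<phi>"
  shows "\<rho> a + \<nu> g \<le> \<nu> (a * g)"
proof (induction g rule: div_induct[OF deg_pos])
  case 1 then show ?case by (simp add: zero)
next
  case (2 g)
  have e: "a * g = a * (g mod \<phi>) + \<phi> * (a * (g div \<phi>))"
    by (metis distrib_left mod_mult_div_eq mult.left_commute)
  have "\<rho> a + \<nu> g \<le> \<nu> (a * (g mod \<phi>))"
  proof (cases "a = 0 \<or> g mod \<phi> = 0")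
    case False
    then show ?thesis by (auto simp: low_mult assms mod_low rec[of g] intro: add_left_mono)
  qed (auto simp: zero)
  moreover have "\<rho> a + \<nu> g \<le> \<nu> (\<phi> * (a * (g div \<phi>)))"
  proof -
    have "\<rho> a + \<nu> g \<le> \<rho> a + (\<gamma> + \<nu> (g div \<phi>))"
      by (rule add_left_mono) (simp add: rec[of g])
    also have "\<dots> = \<gamma> + (\<rho> a + \<nu> (g div \<phi>))" by (simp add: ac_simps)
    also have "\<dots> \<le> \<gamma> + \<nu> (a * (g div \<phi>))" by (rule add_left_mono) (rule 2)
    finally show ?thesis by (simp add: key_mult)
  qed
  ultimately show ?case unfolding e by (rule aug_ge_add)
qed

lemma aug_mult_ge: "\<nu> f + \<nu> g \<le> \<nu> (f * g)"
proof (induction f rule: div_induct[OF deg_pos])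
  case 1 then show ?case by (simp add: zero)
next
  case (2 f)
  have e: "f * g = (f mod \<phi>) * g + \<phi> * ((f div \<phi>) * g)"
    by (metis distrib_right mod_mult_div_eq mult.assoc)
  have "\<nu> f + \<nu> g \<le> \<rho> (f mod \<phi>) + \<nu> g" by (rule add_right_mono) (simp add: rec[of f])
  also have "\<dots> \<le> \<nu> ((f mod \<phi>) * g)" by (rule low_mult_ge[OF mod_low])
  finally have A: "\<nu> f + \<nu> g \<le> \<nu> ((f mod \<phi>) * g)" .
  have "\<nu> f + \<nu> g \<le> (\<gamma> + \<nu> (f div \<phi>)) + \<nu> g"
    by (rule add_right_mono) (simp add: rec[of f])
  also have "\<dots> = \<gamma> + (\<nu> (f div \<phi>) + \<nu> g)" by (simp add: ac_simps)
  also have "\<dots> \<le> \<gamma> + \<nu> ((f div \<phi>) * g)" by (rule add_left_mono) (rule 2)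
  finally have B: "\<nu> f + \<nu> g \<le> \<nu> (\<phi> * ((f div \<phi>) * g))" by (simp add: key_mult)
  show ?case unfolding e using A B by (rule aug_ge_add)
qed

text \<open>
  Split off the terms of the \<open>\<phi>\<close>-expansion below the first one of minimal value; what is left is a
  power of \<open>\<phi>\<close> times a polynomial whose own value is attained at its constant term.
\<close>

lemma leading_part:
  assumes "\<nu> f \<noteq> Infty"
  obtains s F f1 where "f = f1 + \<phi> ^ s * F" "\<nu> f < \<nu> f1" "\<nu> f = nat_mult s \<gamma> + \<nu> F"
    "\<nu> F = \<rho> (F mod \<phi>)"
proof -
  have "\<exists>s F f1. f = f1 + \<phi> ^ s * F \<and> \<nu> f < \<nu> f1 \<and> \<nu> f = nat_mult s \<gamma> + \<nu> F
    \<and> \<nu> F = \<rho> (F mod \<phi>)"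
    using assms
  proof (induction f rule: div_induct[OF deg_pos])
    case 1 then show ?case by (simp add: zero)
  next
    case (2 f)
    show ?case
    proof (cases "\<nu> f = \<rho> (f mod \<phi>)")
      case True
      then show ?thesis using 2
        by (intro exI[of _ 0] exI[of _ f]) (simp add: zero)
    next
      case False
      then have eq: "\<nu> f = \<gamma> + \<nu> (f div \<phi>)" and lt: "\<nu> f < \<rho> (f mod \<phi>)"
        using rec[of f] by (auto simp: min_def split: if_splits)
      then have fin: "\<gamma> \<noteq> Infty" "\<nu> (f div \<phi>) \<noteq> Infty" using 2 by auto
      with 2 obtain s F f1 where IH: "f div \<phi> = f1 + \<phi> ^ s * F" "\<nu> (f div \<phi>) < \<nu> f1"
        "\<nu> (f div \<phi>) = nat_mult s \<gamma> + \<nu> F" "\<nu> F = \<rho> (F mod \<phi>)" by blast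
      have "f = f mod \<phi> + \<phi> * (f1 + \<phi> ^ s * F)"
        by (metis IH(1) mod_mult_div_eq)
      then have "f = (f mod \<phi> + \<phi> * f1) + \<phi> ^ Suc s * F" by (simp add: algebra_simps)
      moreover have "\<nu> f < \<nu> (f mod \<phi> + \<phi> * f1)"
        using lt eq fin IH(2) by (intro aug_gt_add) (auto simp: key_mult low mod_low)
      moreover have "\<nu> f = nat_mult (Suc s) \<gamma> + \<nu> F" using eq IH(3) by (simp add: add.assoc)
      ultimately show ?thesis using IH(4) by blast
    qed
  qed
  then show ?thesis using that by blast
qed

text \<open>
  The constant term of \<open>FG\<close> is the remainder of the product of the constant terms, which bounds
  the value from above.
\<close>

lemma aug_mult_leading:
  assumes "\<nu> F = \<rho> (F mod \<phi>)" "\<nu> G = \<rho> (G mod \<phi>)"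
    "\<nu> F \<noteq> Infty" "\<nu> G \<noteq> Infty"
  shows "\<nu> (F * G) = \<nu> F + \<nu> G"
proof (rule antisym)
  have "F mod \<phi> \<noteq> 0" "G mod \<phi> \<noteq> 0" using assms by auto
  then have "\<rho> ((F mod \<phi>) * (G mod \<phi>) mod \<phi>) = \<nu> F + \<nu> G"
    unfolding assms(1,2) by (intro base_mod mod_low)
  moreover have "(F mod \<phi>) * (G mod \<phi>) mod \<phi> = F * G mod \<phi>" by (simp add: mod_mult_eq)
  ultimately show "\<nu> (F * G) \<le> \<nu> F + \<nu> G" using rec[of "F * G"] by simp
qed (rule aug_mult_ge)

text \<open>
  After \<open>leading_part\<close> the product of the two leading parts has exactly the expected value, and
  all other products have a larger one.
\<close>

lemma aug_mult: "\<nu> (f * g) = \<nu> f + \<nu> g"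
proof (cases "\<nu> f = Infty \<or> \<nu> g = Infty")
  case True
  then show ?thesis using aug_mult_ge[of f g] by auto
next
  case False
  then obtain s F f1 t G g1 where
      f: "f = f1 + \<phi> ^ s * F" "\<nu> f < \<nu> f1" "\<nu> f = nat_mult s \<gamma> + \<nu> F" "\<nu> F = \<rho> (F mod \<phi>)"
    and g: "g = g1 + \<phi> ^ t * G" "\<nu> g < \<nu> g1" "\<nu> g = nat_mult t \<gamma> + \<nu> G" "\<nu> G = \<rho> (G mod \<phi>)"
    by (metis leading_part)
  have fin: "\<nu> F \<noteq> Infty" "\<nu> G \<noteq> Infty" "\<nu> f \<noteq> Infty" "\<nu> g \<noteq> Infty" using f g False by auto
  let ?h = "f1 * g + (\<phi> ^ s * F) * g1"
  let ?H = "\<phi> ^ s * (\<phi> ^ t * (F * G))"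
  have e: "f * g = ?h + ?H" by (simp add: f(1) g(1) algebra_simps)
  have H: "\<nu> ?H = \<nu> f + \<nu> g"
    unfolding key_power_mult aug_mult_leading[OF f(4) g(4) fin(1,2)] f(3) g(3)
    by (simp add: add.assoc add.left_commute)
  have "\<nu> f + \<nu> g < \<nu> f1 + \<nu> g" using f fin by simp
  then have h1: "\<nu> f + \<nu> g < \<nu> (f1 * g)" using aug_mult_ge less_le_trans by blast
  have "\<nu> f + \<nu> g < \<nu> (\<phi> ^ s * F) + \<nu> g1" using f g fin by (simp add: key_power_mult)
  then have h2: "\<nu> f + \<nu> g < \<nu> ((\<phi> ^ s * F) * g1)" using aug_mult_ge less_le_trans by blast
  \<comment> \<open>The remaining products are negligible, and \<open>?H\<close> would be a difference of too large values.\<close>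
  have h: "\<nu> f + \<nu> g < \<nu> ?h" by (rule aug_gt_add[OF h1 h2])
  have neg: "\<nu> (- k) = \<nu> k" for k
  proof -
    have "\<nu> k \<le> \<nu> (- k)" for k
    proof -
      have M: "v (a * b) = v a + v b" "v a = Infty \<longleftrightarrow> a = 0" for a b
        using field_val by (simp_all add: field_valuation_def)
      have "v (- 1) + v (- 1) = v 1" "v 1 = v 1 + v 1" "v 1 \<noteq> Infty"
        using M(1)[of "-1" "-1"] M(1)[of 1 1] M(2)[of 1] by simp_all
      then have "v (-1) = 0" by (cases "v (-1)"; cases "v 1") (auto simp: zero_infty_def)
      moreover have "degree [:- 1 :: 'k:] < degree \<phi>" using deg_pos by simp
      ultimately show ?thesis
        using low_mult_ge[of "[:-1:]" k] by (simp add: base_const)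
    qed
    from this[of k] this[of "- k"] show ?thesis by simp
  qed
  show ?thesis
  proof (rule ccontr)
    assume "\<not> ?thesis"
    then have "\<nu> f + \<nu> g < \<nu> (f * g)" using aug_mult_ge[of f g] by simp
    then have "\<nu> f + \<nu> g < \<nu> (f * g + - ?h)" using h by (intro aug_gt_add) (simp_all only: neg)
    then show False using H e by simp
  qed
qed

theorem poly_valuation_augment: "poly_valuation v \<nu>"
  unfolding poly_valuation_def
  using aug_mult aug_add deg_pos by (simp add: low base_const)

lemma aug_key: "\<nu> \<phi> = \<gamma>"
proof -
  have "\<nu> 1 = 0"
    by (rule valuation.one) (unfold_locales, rule field_val, rule poly_valuation_augment)
  then show ?thesis using key_mult[of 1] by simp
qed

end


lemma monic_dvd_antisym:
  fixes p q :: "'k::field poly"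
  assumes "p dvd q" "q dvd p" "lead_coeff p = 1" "lead_coeff q = 1"
  shows "p = q"
proof -
  obtain k where k: "q = p * k" using assms(1) by (rule dvdE)
  then have lc: "lead_coeff k = 1" using assms(3,4) by (simp add: lead_coeff_mult)
  then have nz: "p \<noteq> 0" "k \<noteq> 0" using assms(3) by auto
  then have "degree k = 0"
    using dvd_imp_degree_le[OF assms(2)] degree_mult_eq[of p k] k by simp
  then have "k = 1" using lc by (intro monic_degree_0)
  then show ?thesis using k by simp
qed

lemma add_self_div_mod:
  fixes a Q :: "'k::field poly"
  assumes "degree a < degree Q"
  shows "(a + Q) div Q = 1" "(a + Q) mod Q = a"
proof -
  have "Q \<noteq> 0" using assms by auto
  then show "(a + Q) div Q = 1" "(a + Q) mod Q = a"
    using assms by (simp_all add: poly_mod_add_left poly_div_add_left mod_poly_less div_poly_less)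
qed

section \<open>Valuations computed from the expansions in a key polynomial\<close>

text \<open>
  The common shape of the valuations of a chain and of the members of its continuous families: the
  valuation \<open>\<nu>\<close> is recovered from its own values below the degree of \<open>\<phi>\<close> and its value at \<open>\<phi>\<close>. The
  origin of \<open>\<nu>\<close>, ordinary or limit, is forgotten.
\<close>

locale key_valuation =
  fixes v :: "'k::field \<Rightarrow> 'g::linordered_ab_group_add infty"
    and \<nu> :: "('k, 'g) pmap" and \<phi> :: "'k poly"
  assumes field_val: "field_valuation v" and augmentable: "augmentable v \<nu> \<phi> (\<nu> \<phi>)"
    and self: "augment \<nu> \<phi> (\<nu> \<phi>) = \<nu>"

lemma (in augmentable_at) key_valuation_augment: "key_valuation v \<nu> \<phi>"
proof
  show "augmentable v \<nu> \<phi> (\<nu> \<phi>)"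
    using augmentable unfolding augmentable_def aug_key
    by (simp add: low degree_add_less mod_low degree_mult_div_less deg_pos)
  have "augment \<nu> \<phi> \<gamma> = augment \<rho> \<phi> \<gamma>"
    by (rule augment_cong[OF deg_pos]) (rule low)
  then show "augment \<nu> \<phi> (\<nu> \<phi>) = \<nu>" by (simp add: aug_key)
qed (rule field_val)

sublocale key_valuation \<subseteq> aug: augmentable_at v \<nu> \<phi> "\<nu> \<phi>"
  by unfold_locales (rule field_val, rule augmentable)

sublocale key_valuation \<subseteq> valuation v \<nu>
  using aug.poly_valuation_augment by unfold_locales (simp_all add: field_val self)

context key_valuation
begin

lemma monic: "lead_coeff \<phi> = 1" and deg_pos: "degree \<phi> > 0"
  by (rule aug.monic aug.deg_pos)+

lemma finite_low: "degree a < degree \<phi> \<Longrightarrow> \<nu> a = Infty \<longleftrightarrow> a = 0"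
  using aug.base_finite by auto

lemma min_formula: "\<nu> f = min (\<nu> (f mod \<phi>)) (\<nu> \<phi> + \<nu> (f div \<phi>))"
  using aug.rec[of f] by (simp add: self)

lemma le_mod: "\<nu> f \<le> \<nu> (f mod \<phi>)"
  by (subst min_formula) simp

lemma eq_0_of_Infty:
  assumes "\<nu> \<phi> \<noteq> Infty" shows "\<nu> f = Infty \<longleftrightarrow> f = 0"
proof -
  have "\<nu> f = Infty \<longrightarrow> f = 0"
  proof (induction f rule: div_induct[OF deg_pos])
    case (2 f)
    show ?case
    proof
      assume "\<nu> f = Infty"
      then have "\<nu> (f mod \<phi>) = Infty" "\<nu> (f div \<phi>) = Infty"
        using min_formula[of f] assms by (auto simp: min_def split: if_splits)
      then have "f mod \<phi> = 0" "f div \<phi> = 0" using 2 aug.mod_low finite_low by auto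
      then show "f = 0" by (metis mod_mult_div_eq add_0 mult_zero_right)
    qed
  qed simp
  then show ?thesis by auto
qed

lemma Infty_iff:
  assumes "\<nu> \<phi> = Infty" shows "\<nu> f = Infty \<longleftrightarrow> \<phi> dvd f"
  using min_formula[of f] assms finite_low[OF aug.mod_low, of f]
  by (auto simp: min_def dvd_eq_mod_eq_0 split: if_splits)

text \<open>
  A proper factorization of \<open>\<phi>\<close> would be a product of small polynomials with remainder 0, of
  infinite value; so the Euclidean algorithm for \<open>a\<close> and \<open>\<phi>\<close> ends in a unit.
\<close>

lemma bezout_low: "degree a < degree \<phi> \<Longrightarrow> a \<noteq> 0 \<Longrightarrow> \<exists>b q. a * b = 1 + \<phi> * q"
proof (induction "degree a" arbitrary: a rule: less_induct)
  case less
  show ?case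
  proof (cases "degree a = 0")
    case True
    then obtain c where "a = [:c:]" by (rule degree_eq_zeroE)
    with less show ?thesis
      by (intro exI[of _ "[:inverse c:]"] exI[of _ 0]) (simp add: one_pCons)
  next
    case False
    let ?s = "\<phi> div a" and ?r = "\<phi> mod a"
    have e: "\<phi> = a * ?s + ?r" by simp
    have s: "degree ?s < degree \<phi>" by (rule degree_div_lt) (use False deg_pos in auto)
    have r: "degree ?r < degree a" by (rule degree_mod_lt) (use False in simp)
    have "?r \<noteq> 0"
    proof
      assume r0: "?r = 0"
      then have as: "a * ?s = \<phi>" using e by simp
      then have "?s \<noteq> 0" using aug.nonzero by auto
      then have "\<nu> a + \<nu> ?s = Infty"
        using aug.base_mod[OF less(2) s less(3)] as by simp
      then show False using finite_low less s \<open>?s \<noteq> 0\<close> by auto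
    qed
    then obtain b q where bq: "?r * b = 1 + \<phi> * q"
      using less(1)[OF r] less_trans[OF r less(2)] by blast
    have "a * (- ?s * b) = ?r * b - \<phi> * b"
      unfolding minus_mult_div_eq_mod[symmetric] by (simp add: algebra_simps)
    also have "\<dots> = 1 + \<phi> * (q - b)" using bq by (simp add: algebra_simps)
    finally show ?thesis by blast
  qed
qed

lemma bezout:
  assumes "\<not> \<phi> dvd f"
  shows "\<exists>b q. degree b < degree \<phi> \<and> f * b = 1 + \<phi> * q"
proof -
  have "f mod \<phi> \<noteq> 0" using assms by (simp add: dvd_eq_mod_eq_0)
  then obtain b q where bq: "(f mod \<phi>) * b = 1 + \<phi> * q" using bezout_low aug.mod_low by blast
  have "f * (b mod \<phi>) = (f mod \<phi> + \<phi> * (f div \<phi>)) * (b - \<phi> * (b div \<phi>))"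
    by (simp add: minus_mult_div_eq_mod)
  also have "\<dots> = (f mod \<phi>) * b + \<phi> * ((f div \<phi>) * b - (f mod \<phi> + \<phi> * (f div \<phi>)) * (b div \<phi>))"
    by (simp only: algebra_simps)
  also have "\<dots> = (f mod \<phi>) * b + \<phi> * ((f div \<phi>) * b - f * (b div \<phi>))"
    by simp
  also have "\<dots> = 1 + \<phi> * (q + ((f div \<phi>) * b - f * (b div \<phi>)))"
    unfolding bq by (simp add: algebra_simps)
  finally show ?thesis using aug.mod_low by blast
qed

lemma val_dvd_key_iff: "val_dvd \<nu> \<phi> f \<longleftrightarrow> \<nu> f < \<nu> (f mod \<phi>)"
proof
  assume "val_dvd \<nu> \<phi> f"
  then obtain h where "\<nu> f < \<nu> (f - \<phi> * h)" by (auto simp: val_dvd_iff)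
  also have "\<dots> \<le> \<nu> ((f - \<phi> * h) mod \<phi>)" by (rule le_mod)
  also have "(f - \<phi> * h) mod \<phi> = f mod \<phi>" by (simp add: poly_mod_diff_left)
  finally show "\<nu> f < \<nu> (f mod \<phi>)" .
next
  assume "\<nu> f < \<nu> (f mod \<phi>)"
  then show "val_dvd \<nu> \<phi> f" unfolding val_dvd_iff by (metis minus_mult_div_eq_mod)
qed

text \<open>
  Divisibility by \<open>\<phi>\<close> in the graded algebra means that the constant term of the expansion has too
  large a value. Primality holds since constant terms multiply up to remainders.
\<close>

lemma key_in_KP:
  assumes "\<nu> \<phi> \<noteq> Infty" shows "\<phi> \<in> KP \<nu>"
proof -
  have ndvd: "\<not> val_dvd \<nu> \<phi> f \<longleftrightarrow> \<nu> (f mod \<phi>) = \<nu> f" for f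
    using le_mod[of f] by (auto simp: val_dvd_key_iff)
  have 1: "\<not> val_dvd \<nu> \<phi> 1" unfolding ndvd using deg_pos by (simp add: mod_poly_less)
  have 2: "val_dvd \<nu> \<phi> f \<or> val_dvd \<nu> \<phi> g" if fg: "val_dvd \<nu> \<phi> (f * g)" for f g
  proof (rule ccontr)
    assume "\<not> ?thesis"
    then have e: "\<nu> (f mod \<phi>) = \<nu> f" "\<nu> (g mod \<phi>) = \<nu> g" using ndvd by auto
    have "\<nu> (f * g mod \<phi>) = \<nu> f + \<nu> g"
    proof (cases "f mod \<phi> = 0 \<or> g mod \<phi> = 0")
      case True
      then have "f * g mod \<phi> = 0" by (subst mod_mult_eq[symmetric]) auto
      then show ?thesis using True e by auto
    next
      case False
      then show ?thesis
        using aug.base_mod[OF aug.mod_low aug.mod_low, of f g] e by (simp add: mod_mult_eq)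
    qed
    then show False using fg by (simp add: val_dvd_key_iff)
  qed
  have 3: "degree \<phi> \<le> degree f" if "val_dvd \<nu> \<phi> f" for f
    using that unfolding val_dvd_key_iff by (cases "degree f < degree \<phi>") (auto simp: mod_poly_less)
  have 4: "support \<nu> = {0}" using eq_0_of_Infty[OF assms] by (auto simp: support_def)
  show ?thesis unfolding KP_def using 1 2 3 4 monic by auto
qed

text \<open>
  A polynomial of smaller degree is a unit in the graded algebra: its inverse \<open>b\<close> modulo \<open>\<phi>\<close> satisfies
  \<open>\<chi>b = 1 + \<phi>q\<close>, where \<open>\<phi>q\<close> has positive value.
\<close>

lemma degree_KP:
  assumes "\<chi> \<in> KP \<nu>" shows "degree \<phi> \<le> degree \<chi>"
proof (rule ccontr)
  assume "\<not> ?thesis"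
  then have lt: "degree \<chi> < degree \<phi>" by simp
  have "lead_coeff \<chi> = 1" using assms by (simp add: KP_def)
  then have nz: "\<chi> \<noteq> 0" by auto
  then have "\<not> \<phi> dvd \<chi>" using lt dvd_imp_degree_le leD by blast
  then obtain b q where b: "degree b < degree \<phi>" "\<chi> * b = 1 + \<phi> * q" using bezout by blast
  have m: "\<chi> * b mod \<phi> = 1" "\<chi> * b div \<phi> = q"
    unfolding b(2) using deg_pos by (auto simp: mod_poly_less poly_mod_add_left
        poly_div_add_left div_poly_less)
  then have "b \<noteq> 0" by auto
  then have "\<nu> 1 = \<nu> \<chi> + \<nu> b" "\<nu> \<chi> + \<nu> b < \<nu> \<phi> + \<nu> q"
    using aug.base_mod[OF lt b(1) nz] aug.base_div[OF lt b(1) nz] m by auto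
  then have "\<nu> 1 < \<nu> (1 - \<chi> * b)" unfolding b(2) by simp
  then have "val_dvd \<nu> \<chi> 1" unfolding val_dvd_iff by blast
  then show False using assms by (simp add: KP_def)
qed

lemma support_generators_eq:
  assumes "\<nu> \<phi> = Infty" shows "support_generators \<nu> = {\<phi>}"
proof -
  have s: "support \<nu> = {f. \<phi> dvd f}" using Infty_iff[OF assms] by (simp add: support_def)
  have "\<psi> = \<phi>" if "lead_coeff \<psi> = 1" "{f. \<phi> dvd f} = {\<psi> * h |h. True}" for \<psi>
  proof (rule monic_dvd_antisym)
    have "\<psi> * 1 \<in> {f. \<phi> dvd f}" unfolding that(2) by blast
    then show "\<phi> dvd \<psi>" by simp
    have "\<phi> \<in> {f. \<phi> dvd f}" by simp
    then show "\<psi> dvd \<phi>" unfolding that(2) by auto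
  qed (rule that(1) monic)+
  moreover have "{f. \<phi> dvd f} = {\<phi> * h |h. True}" by (auto simp: dvd_def)
  ultimately show ?thesis unfolding support_generators_def s using monic by auto
qed

lemma support_nontrivial: "\<nu> \<phi> = Infty \<Longrightarrow> support \<nu> \<noteq> {0}"
  using aug.nonzero by (auto simp: support_def)

lemma support_trivial: "\<nu> \<phi> \<noteq> Infty \<Longrightarrow> support \<nu> = {0}"
  using eq_0_of_Infty by (auto simp: support_def)

lemma val_degree_eq: "val_degree \<nu> = degree \<phi>"
proof (cases "\<nu> \<phi> = Infty")
  case True
  then show ?thesis unfolding val_degree_def
    by (simp add: support_nontrivial support_generators_eq Least_equality)
next
  case False
  then show ?thesis unfolding val_degree_def
    using key_in_KP degree_KP by (auto simp: support_trivial intro!: Least_equality)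
qed

lemma key_in_minimal_polys: "\<phi> \<in> minimal_polys \<nu>"
  using key_in_KP support_generators_eq support_trivial support_nontrivial val_degree_eq
  by (cases "\<nu> \<phi> = Infty") (auto simp: minimal_polys_def)

text \<open>
  If the support is nonzero, \<open>\<phi>\<close> is its only monic generator. Otherwise a difference \<open>\<psi> - \<phi>\<close> of
  value less than \<open>\<nu>(\<phi>)\<close> would be divisible by \<open>\<psi>\<close> in the graded algebra in spite of its small degree.
\<close>

lemma minimal_polysD:
  assumes "\<psi> \<in> minimal_polys \<nu>"
  shows "lead_coeff \<psi> = 1" "degree \<psi> = degree \<phi>" "\<nu> \<phi> \<le> \<nu> (\<psi> - \<phi>)"
proof -
  have "lead_coeff \<psi> = 1 \<and> degree \<psi> = degree \<phi> \<and> \<nu> \<phi> \<le> \<nu> (\<psi> - \<phi>)"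
  proof (cases "\<nu> \<phi> = Infty")
    case True
    then have "\<psi> = \<phi>" using assms
      by (simp add: minimal_polys_def support_nontrivial support_generators_eq)
    then show ?thesis using monic by simp
  next
    case False
    then have kp: "\<psi> \<in> KP \<nu>" and d: "degree \<psi> = degree \<phi>"
      using assms by (simp_all add: minimal_polys_def support_trivial val_degree_eq)
    then have m: "lead_coeff \<psi> = 1" by (simp add: KP_def)
    have lt: "degree (\<psi> - \<phi>) < degree \<psi>" using m monic d deg_pos by (intro monic_diff_degree) auto
    have "\<nu> \<phi> \<le> \<nu> (\<psi> - \<phi>)"
    proof (rule ccontr)
      assume n: "\<not> ?thesis"
      then have "\<nu> (\<psi> - \<phi>) < \<nu> ((\<psi> - \<phi>) - \<psi> * 1)" by simp
      then have "val_dvd \<nu> \<psi> (\<psi> - \<phi>)" unfolding val_dvd_iff by blast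
      moreover have "\<psi> - \<phi> \<noteq> 0" using n by auto
      ultimately show False using kp lt by (auto simp: KP_def)
    qed
    then show ?thesis using m d by simp
  qed
  then show "lead_coeff \<psi> = 1" "degree \<psi> = degree \<phi>" "\<nu> \<phi> \<le> \<nu> (\<psi> - \<phi>)" by auto
qed

lemma value_minimal_poly: "\<psi> \<in> minimal_polys \<nu> \<Longrightarrow> \<nu> \<phi> \<le> \<nu> \<psi>"
  using minimal_polysD(3)[of \<psi>] ge_add[of "\<nu> \<phi>" "\<psi> - \<phi>" \<phi>] by simp

lemma monic_value_le:
  assumes "lead_coeff Q = 1" "degree Q = degree \<phi>"
  shows "\<nu> Q \<le> \<nu> \<phi>"
proof -
  have "degree (Q - \<phi>) < degree \<phi>" using assms monic monic_diff_degree[of Q \<phi>] deg_pos by simp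
  then have "(Q - \<phi> + \<phi>) div \<phi> = 1" by (rule add_self_div_mod)
  then show ?thesis using min_formula[of Q] by simp
qed

end


text \<open>
  A polynomial \<open>f\<close> outside the support has an inverse \<open>b\<close> modulo \<open>\<phi>\<close>, so the values of \<open>f\<close> and \<open>b\<close>
  add up to 0 for both valuations and neither can grow.
\<close>

lemma (in key_valuation) maximal_if_Infty:
  assumes "\<nu> \<phi> = Infty" "valuation v \<nu>'" "\<And>f. \<nu> f \<le> \<nu>' f"
  shows "\<nu>' f = \<nu> f"
proof (cases "\<phi> dvd f")
  case True
  then show ?thesis using Infty_iff[OF assms(1), of f] assms(3)[of f] by simp
next
  case False
  interpret \<nu>': valuation v \<nu>' by fact
  obtain b q where e: "f * b = 1 + \<phi> * q" using bezout[OF False] by blast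
  have "\<nu>' \<phi> = Infty" using assms(1) assms(3)[of \<phi>] by simp
  then have 1: "\<nu>' f + \<nu>' b = 0"
    using \<nu>'.add_eq[of 1 "\<phi> * q"] arg_cong[OF e, of \<nu>'] by simp
  have 2: "\<nu> f + \<nu> b = 0"
    using add_eq[of 1 "\<phi> * q"] arg_cong[OF e, of \<nu>] assms(1) by simp
  then have "\<nu> b \<noteq> Infty" by auto
  then have "\<not> \<nu> f < \<nu>' f"
    using infty_add_less_le_mono[of "\<nu> f" "\<nu>' f" "\<nu> b" "\<nu>' b"] 1 2 assms(3) by auto
  then show ?thesis using assms(3)[of f] by simp
qed


section \<open>Key polynomials and tangent directions give augmentations\<close>

lemma (in valuation) le_key_mult:
  "\<mu> f \<le> \<mu> (f mod Q) \<Longrightarrow> \<mu> f \<le> \<mu> (Q * (f div Q))"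
  using ge_diff[of "\<mu> f" f "f mod Q"] by (simp only: minus_mod_eq_mult_div)

lemma (in valuation) KP_degree_pos:
  assumes "\<phi> \<in> KP \<mu>" shows "degree \<phi> > 0"
proof (rule ccontr)
  assume "\<not> ?thesis"
  then have "degree \<phi> = 0" by simp
  moreover have "lead_coeff \<phi> = 1" using assms by (simp add: KP_def)
  ultimately have "\<phi> = 1" by (rule monic_degree_0[rotated])
  moreover have "val_dvd \<mu> 1 1" unfolding val_dvd_iff by (rule exI[of _ 1]) simp
  ultimately show False using assms by (simp add: KP_def)
qed

lemma (in valuation) KP_le_mod:
  assumes "\<phi> \<in> KP \<mu>" shows "\<mu> f \<le> \<mu> (f mod \<phi>)"
proof (rule ccontr)
  assume n: "\<not> ?thesis"
  have "\<mu> (f mod \<phi> - \<phi> * (- (f div \<phi>))) = \<mu> f" by simp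
  then have "val_dvd \<mu> \<phi> (f mod \<phi>)" unfolding val_dvd_iff using n by (metis not_le)
  moreover have "f mod \<phi> \<noteq> 0" using n by auto
  ultimately have "degree \<phi> \<le> degree (f mod \<phi>)" using assms by (simp add: KP_def)
  then show False using degree_mod_lt[OF KP_degree_pos[OF assms], of f] by simp
qed

text \<open>
  By primality and minimality \<open>\<phi>\<close> does not divide \<open>ab\<close> in the graded algebra, which is the equality
  for the remainder; the strict inequality comes from \<open>\<mu>(\<phi>) < \<gamma>\<close>.
\<close>

lemma (in valuation) KP_augmentable:
  assumes "\<phi> \<in> KP \<mu>" "\<mu> \<phi> < \<gamma>"
  shows "augmentable v \<mu> \<phi> \<gamma>"
proof -
  have supp: "\<mu> f = Infty \<longleftrightarrow> f = 0" for f
    using assms(1) by (simp add: KP_def support_def set_eq_iff)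
  have "\<mu> (a * b mod \<phi>) = \<mu> a + \<mu> b \<and> \<mu> a + \<mu> b < \<gamma> + \<mu> (a * b div \<phi>)"
    if ab: "degree a < degree \<phi>" "degree b < degree \<phi>" "a \<noteq> 0" "b \<noteq> 0" for a b
  proof
    have "\<not> val_dvd \<mu> \<phi> a" "\<not> val_dvd \<mu> \<phi> b"
      using assms(1) ab leD unfolding KP_def by blast+
    then have "\<not> val_dvd \<mu> \<phi> (a * b)" using assms(1) unfolding KP_def by blast
    then have "\<not> \<mu> (a * b) < \<mu> (a * b mod \<phi>)"
      unfolding val_dvd_iff by (metis minus_mult_div_eq_mod)
    then show "\<mu> (a * b mod \<phi>) = \<mu> a + \<mu> b" using KP_le_mod[OF assms(1), of "a * b"] by simp
    have "\<mu> a + \<mu> b \<le> \<mu> \<phi> + \<mu> (a * b div \<phi>)"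
      using le_key_mult[OF KP_le_mod[OF assms(1), of "a * b"]] by simp
    then show "\<mu> a + \<mu> b < \<gamma> + \<mu> (a * b div \<phi>)"
      using assms(2) supp ab by (cases "\<mu> (a * b div \<phi>) = Infty") (auto intro: le_less_trans)
  qed
  then show ?thesis
    using assms(1) KP_degree_pos[OF assms(1)] add_ge supp unfolding augmentable_def
    by (simp add: KP_def)
qed

lemma (in valuation) KP_augment_ge:
  assumes "\<phi> \<in> KP \<mu>" "\<mu> \<phi> < \<gamma>"
  shows "\<mu> f \<le> augment \<mu> \<phi> \<gamma> f"
proof (induction f rule: div_induct[OF KP_degree_pos[OF assms(1)]])
  case (2 f)
  have "\<mu> f \<le> \<mu> \<phi> + \<mu> (f div \<phi>)" using le_key_mult[OF KP_le_mod[OF assms(1), of f]] by simp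
  also have "\<dots> \<le> \<gamma> + augment \<mu> \<phi> \<gamma> (f div \<phi>)" using 2 assms by (intro add_mono) simp_all
  finally show ?case
    using KP_le_mod[OF assms(1), of f] by (subst augment_rec) (use KP_degree_pos assms in auto)
qed (use KP_degree_pos assms in simp)

text \<open>
  The polynomial \<open>Q\<close> has minimal degree among those whose value grows from \<open>\<mu>\<close> to \<open>\<nu>\<close>. This replaces
  the inclusion of the tangent direction in \<open>KP \<mu>\<close>: it yields directly that the truncation of \<open>\<nu>\<close> at
  \<open>Q\<close> is a valuation.
\<close>

locale tangent = mu: valuation v \<mu> + nu: valuation v \<nu>
  for v :: "'k::field \<Rightarrow> 'g::linordered_ab_group_add infty" and \<mu> \<nu> :: "('k, 'g) pmap" +
  fixes Q :: "'k poly"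
  assumes le: "\<mu> f \<le> \<nu> f" and monic: "lead_coeff Q = 1" and deg_pos: "degree Q > 0"
    and low_eq: "degree a < degree Q \<Longrightarrow> \<mu> a = \<nu> a"
    and low_finite: "degree a < degree Q \<Longrightarrow> \<nu> a = Infty \<Longrightarrow> a = 0"
    and less: "\<mu> Q < \<nu> Q"
begin

text \<open>
  Otherwise the remainder and the multiple \<open>Q(f div Q)\<close> would cancel, for \<open>\<mu>\<close> and for \<open>\<nu>\<close>. The value of
  the remainder is the same for both, but that of the multiple grows.
\<close>

lemma le_mod: "\<mu> f \<le> \<mu> (f mod Q)"
proof (rule ccontr)
  assume "\<not> ?thesis"
  then have n: "\<mu> (f mod Q) < \<mu> f" by simp
  have e: "f mod Q - f = - (Q * (f div Q))" by (simp add: minus_mult_div_eq_mod[symmetric])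
  have m: "\<mu> (Q * (f div Q)) = \<mu> (f mod Q)" using mu.diff_eq[OF n] by (simp only: e mu.uminus)
  have "\<nu> (f mod Q) = \<mu> (f mod Q)" using low_eq degree_mod_lt[OF deg_pos, of f] by simp
  then have "\<nu> (f mod Q) < \<nu> f" using n le[of f] by simp
  then have "\<nu> (Q * (f div Q)) = \<mu> (f mod Q)"
    using nu.diff_eq \<open>\<nu> (f mod Q) = _\<close> by (metis e nu.uminus)
  then have "\<mu> Q + \<mu> (f div Q) = \<nu> Q + \<nu> (f div Q)" using m by simp
  moreover have "\<mu> (f div Q) \<noteq> Infty" using m n by auto
  then have "\<mu> Q + \<mu> (f div Q) < \<nu> Q + \<nu> (f div Q)"
    using less le by (intro infty_add_less_le_mono)
  ultimately show False by simp
qed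

lemma augmentable: "augmentable v \<nu> Q (\<nu> Q)"
proof -
  have "\<nu> (a * b mod Q) = \<nu> a + \<nu> b \<and> \<nu> a + \<nu> b < \<nu> Q + \<nu> (a * b div Q)"
    if ab: "degree a < degree Q" "degree b < degree Q" "a \<noteq> 0" "b \<noteq> 0" for a b
  proof -
    have fin: "\<nu> (a * b) \<noteq> Infty" using ab low_finite by auto
    have eq: "\<mu> (a * b) = \<nu> (a * b)" using ab low_eq by simp
    have q: "\<mu> (a * b div Q) = \<nu> (a * b div Q)" using ab by (intro low_eq degree_mult_div_less)
    have "\<mu> (a * b) \<le> \<mu> Q + \<mu> (a * b div Q)" using mu.le_key_mult[OF le_mod[of "a * b"]] by simp
    then have lt: "\<nu> (a * b) < \<nu> (Q * (a * b div Q))"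
      unfolding nu.mult[of Q] eq q using less fin
      by (cases "\<nu> (a * b div Q) = Infty") (auto intro: le_less_trans)
    have "\<nu> (a * b mod Q) = \<nu> (a * b)"
      using nu.diff_eq[OF lt] by (simp only: minus_mult_div_eq_mod)
    then show ?thesis using lt by simp
  qed
  then show ?thesis
    unfolding augmentable_def using monic deg_pos low_finite nu.add_ge by simp
qed

sublocale aug: augmentable_at v \<nu> Q "\<nu> Q"
  by unfold_locales (rule mu.field_val, rule augmentable)

sublocale trunc: key_valuation v "augment \<nu> Q (\<nu> Q)" Q
  by (rule aug.key_valuation_augment)

end


section \<open>Continuous families\<close>

text \<open>
  The filter of the final segments of the index set turns \<open>eventually_equal\<close> into the
  \<open>eventually\<close> of filters, which makes the lemmas on conjunctions available.
\<close>

definition tails :: "'i rel \<Rightarrow> 'i filter" where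
  "tails r = (INF i\<in>Field r. principal {j. (i, j) \<in> r})"

locale augmentation_family = mu: valuation v \<mu>
  for v :: "'k::field \<Rightarrow> 'g::linordered_ab_group_add infty" and \<mu> :: "('k, 'g) pmap" +
  fixes r :: "'i rel" and \<rho> :: "'i \<Rightarrow> ('k, 'g) pmap"
  assumes continuous: "continuous_augmentations v \<mu> r \<rho>"
begin

lemma family: "continuous_family v r \<rho>"
  using continuous by (simp add: continuous_augmentations_def)

lemma well_order: "Well_order r" and nonempty: "Field r \<noteq> {}"
  and no_last: "i \<in> Field r \<Longrightarrow> \<exists>j. (i, j) \<in> r \<and> j \<noteq> i"
  and member_poly_valuation: "i \<in> Field r \<Longrightarrow> poly_valuation v (\<rho> i)"
  and order_iff: "i \<in> Field r \<Longrightarrow> j \<in> Field r \<Longrightarrow> (i, j) \<in> r \<longleftrightarrow> \<rho> i \<le> \<rho> j"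
  using family by (auto simp: continuous_family_def)

lemma in_Field: "(i, j) \<in> r \<Longrightarrow> i \<in> Field r" "(i, j) \<in> r \<Longrightarrow> j \<in> Field r"
  by (auto simp: Field_def)

lemma reflexive: "i \<in> Field r \<Longrightarrow> (i, i) \<in> r"
  by (simp add: order_iff)

lemma transitive: "(i, j) \<in> r \<Longrightarrow> (j, k) \<in> r \<Longrightarrow> (i, k) \<in> r"
  using order_iff in_Field order_trans by metis

lemma total: "i \<in> Field r \<Longrightarrow> j \<in> Field r \<Longrightarrow> (i, j) \<in> r \<or> (j, i) \<in> r"
  using well_order reflexive
  by (cases "i = j") (auto simp: well_order_on_def linear_order_on_def total_on_def)

lemma antisymmetric: "(i, j) \<in> r \<Longrightarrow> (j, i) \<in> r \<Longrightarrow> i = j"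
  using well_order
  by (auto simp: well_order_on_def linear_order_on_def partial_order_on_def dest: antisymD)

lemma increasing: "(i, j) \<in> r \<Longrightarrow> \<rho> i f \<le> \<rho> j f"
  using order_iff[of i j] in_Field[of i j] by (auto simp: le_fun_def)

lemma eventually_tails: "eventually P (tails r) \<longleftrightarrow> (\<exists>i\<in>Field r. \<forall>j. (i, j) \<in> r \<longrightarrow> P j)"
proof -
  have "eventually P (tails r) \<longleftrightarrow> (\<exists>i\<in>Field r. eventually P (principal {j. (i, j) \<in> r}))"
    unfolding tails_def
  proof (rule eventually_INF_base[OF nonempty])
    fix a b assume ab: "a \<in> Field r" "b \<in> Field r"
    show "\<exists>x\<in>Field r. principal {j. (x, j) \<in> r} \<le> inf (principal {j. (a, j) \<in> r}) (principal {j. (b, j) \<in> r})"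
      using total[OF ab] transitive ab by (auto intro: bexI[of _ a] bexI[of _ b])
  qed
  then show ?thesis by (simp add: eventually_principal)
qed

lemma eventually_ge: "i \<in> Field r \<Longrightarrow> eventually (\<lambda>j. (i, j) \<in> r) (tails r)"
  unfolding eventually_tails by blast

lemma eventually_exists: "eventually P (tails r) \<Longrightarrow> \<exists>i\<in>Field r. P i"
  unfolding eventually_tails using reflexive by blast

lemma eventually_equal_iff: "eventually_equal r g c \<longleftrightarrow> eventually (\<lambda>i. g i = c) (tails r)"
  by (simp add: eventually_tails eventually_equal_def)

lemma eventual_value_eq:
  assumes "eventually (\<lambda>i. g i = c) (tails r)" shows "eventual_value r g = c"
  unfolding eventual_value_def
proof (rule the_equality)
  fix d assume "eventually_equal r g d"
  then have "eventually (\<lambda>i. g i = d \<and> g i = c) (tails r)"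
    using assms by (auto simp: eventually_equal_iff intro: eventually_conj)
  then show "d = c" using eventually_exists by blast
qed (use assms in \<open>simp add: eventually_equal_iff\<close>)

lemma stable_limit_eq: "eventually (\<lambda>i. \<rho> i f = c) (tails r) \<Longrightarrow> stable_limit r \<rho> f = c"
  unfolding stable_limit_def by (rule eventual_value_eq)

lemma stableI: "eventually (\<lambda>i. \<rho> i f = c) (tails r) \<Longrightarrow> stable r \<rho> f"
  by (auto simp: stable_def eventually_equal_iff)

lemma stableD: "stable r \<rho> f \<Longrightarrow> eventually (\<lambda>i. \<rho> i f = stable_limit r \<rho> f) (tails r)"
  by (metis stable_def eventually_equal_iff stable_limit_eq)

lemma le_stable_limit:
  assumes "stable r \<rho> f" "i \<in> Field r" shows "\<rho> i f \<le> stable_limit r \<rho> f"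
proof -
  have "eventually (\<lambda>j. \<rho> j f = stable_limit r \<rho> f \<and> (i, j) \<in> r) (tails r)"
    by (intro eventually_conj stableD eventually_ge assms)
  then obtain j where "\<rho> j f = stable_limit r \<rho> f" "(i, j) \<in> r"
    using eventually_exists by blast
  then show ?thesis using increasing[of i j f] by simp
qed

lemma unstable_grows:
  assumes "\<not> stable r \<rho> f" "i \<in> Field r"
  shows "\<exists>j. (i, j) \<in> r \<and> \<rho> i f < \<rho> j f"
proof (rule ccontr)
  assume n: "\<not> ?thesis"
  have "\<rho> j f = \<rho> i f" if "(i, j) \<in> r" for j
    using n that increasing[OF that, of f] by (auto simp: less_le)
  then have "eventually (\<lambda>j. \<rho> j f = \<rho> i f) (tails r)"
    unfolding eventually_tails using assms(2) by blast
  then show False using assms(1) stableI by blast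
qed

lemma member_valuation: "i \<in> Field r \<Longrightarrow> valuation v (\<rho> i)"
  using member_poly_valuation mu.field_val by unfold_locales auto

text \<open>A choice of the polynomials \<open>\<chi>\<^sub>i\<close> in the definition of a continuous family of augmentations.\<close>

definition key :: "'i \<Rightarrow> 'k poly" where
  "key i = (SOME \<chi>. \<exists>\<beta>. ordinary_augmentation \<mu> \<chi> \<beta> (\<rho> i))"

lemma member_augmentation:
  assumes "i \<in> Field r"
  shows "key i \<in> KP \<mu>" "\<mu> (key i) < \<rho> i (key i)" "\<rho> i = augment \<mu> (key i) (\<rho> i (key i))"
    and member_key: "key_valuation v (\<rho> i) (key i)"
    and member_low: "degree a < degree (key i) \<Longrightarrow> \<rho> i a = \<mu> a"
    and member_ge: "\<mu> f \<le> \<rho> i f"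
proof -
  have "\<exists>\<chi> \<beta>. ordinary_augmentation \<mu> \<chi> \<beta> (\<rho> i)"
    using continuous assms by (simp add: continuous_augmentations_def)
  then have "\<exists>\<beta>. ordinary_augmentation \<mu> (key i) \<beta> (\<rho> i)"
    unfolding key_def by (rule someI_ex)
  then obtain \<beta> where \<beta>: "key i \<in> KP \<mu>" "\<mu> (key i) < \<beta>" "\<rho> i = augment \<mu> (key i) \<beta>"
    by (auto simp: ordinary_augmentation_def)
  interpret augmentable_at v \<mu> "key i" \<beta>
    by unfold_locales (rule mu.field_val, rule mu.KP_augmentable[OF \<beta>(1,2)])
  show "key i \<in> KP \<mu>" by fact
  show "\<mu> (key i) < \<rho> i (key i)" "\<rho> i = augment \<mu> (key i) (\<rho> i (key i))"
    using \<beta> aug_key by simp_all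
  show "key_valuation v (\<rho> i) (key i)" using key_valuation_augment \<beta>(3) by simp
  show "degree a < degree (key i) \<Longrightarrow> \<rho> i a = \<mu> a" using low \<beta>(3) by simp
  show "\<mu> f \<le> \<rho> i f" using mu.KP_augment_ge[OF \<beta>(1,2)] \<beta>(3) by simp
qed

text \<open>
  A member with nonzero support would be maximal among all valuations, but there is no last member.
\<close>

lemma member_finite:
  assumes i: "i \<in> Field r" shows "\<rho> i f = Infty \<longleftrightarrow> f = 0"
proof -
  interpret key_valuation v "\<rho> i" "key i" by (rule member_key[OF i])
  have "\<rho> i (key i) \<noteq> Infty"
  proof
    assume inf: "\<rho> i (key i) = Infty"
    obtain j where j: "(i, j) \<in> r" "j \<noteq> i" using no_last[OF i] by blast
    have "\<rho> j f = \<rho> i f" for f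
      by (rule maximal_if_Infty[OF inf member_valuation]) (use j in_Field increasing in auto)
    then have "\<rho> j = \<rho> i" by blast
    then have "(j, i) \<in> r" using order_iff[of j i] j in_Field by auto
    then show False using j antisymmetric by blast
  qed
  then show ?thesis by (rule eq_0_of_Infty)
qed

end


section \<open>Limit augmentations\<close>

locale limit_augmentable = augmentation_family v \<mu> r \<rho>
  for v :: "'k::field \<Rightarrow> 'g::linordered_ab_group_add infty" and \<mu> :: "('k, 'g) pmap"
    and r :: "'i rel" and \<rho> :: "'i \<Rightarrow> ('k, 'g) pmap" +
  fixes \<phi> :: "'k poly" and \<gamma> :: "'g infty"
  assumes limit_key: "\<phi> \<in> limit_KP r \<rho>" and above: "i \<in> Field r \<Longrightarrow> \<rho> i \<phi> < \<gamma>"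
begin

abbreviation lim :: "('k, 'g) pmap" where "lim \<equiv> stable_limit r \<rho>"

lemma unstable: "\<not> stable r \<rho> \<phi>" and monic: "lead_coeff \<phi> = 1"
  using limit_key by (simp_all add: limit_KP_def)

lemma low_stable:
  assumes "degree f < degree \<phi>" shows "stable r \<rho> f"
proof (rule ccontr)
  assume "\<not> ?thesis"
  then have "unstable_degree r \<rho> \<le> enat (degree f)"
    unfolding unstable_degree_def by (intro Inf_lower) auto
  also have "\<dots> < enat (degree \<phi>)" using assms by simp
  also have "\<dots> = unstable_degree r \<rho>" using limit_key by (simp add: limit_KP_def)
  finally show False by simp
qed

lemma const_eventually: "eventually (\<lambda>i. \<rho> i [:c:] = v c) (tails r)"
  unfolding eventually_tails using nonempty in_Field(2) member_poly_valuation
  by (auto simp: poly_valuation_def)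

lemma deg_pos: "degree \<phi> > 0"
proof (rule ccontr)
  assume "\<not> ?thesis"
  then obtain c where "\<phi> = [:c:]" using degree_eq_zeroE by blast
  then show False using unstable stableI[OF const_eventually] by blast
qed

text \<open>
  The factor \<open>\<phi>\<close> is unstable and the other factor cannot compensate its growth.
\<close>

lemma key_multiple_grows:
  assumes "k \<in> Field r" "V \<noteq> Infty" "\<And>j. (k, j) \<in> r \<Longrightarrow> \<rho> j (\<phi> * q) = V"
  shows False
proof -
  obtain j where j: "(k, j) \<in> r" "\<rho> k \<phi> < \<rho> j \<phi>" using unstable_grows[OF unstable assms(1)] by blast
  interpret k: valuation v "\<rho> k" using assms(1) by (rule member_valuation)
  interpret j: valuation v "\<rho> j" using j(1) by (intro member_valuation in_Field)
  have k: "\<rho> k \<phi> + \<rho> k q = V" using assms(3)[OF reflexive[OF assms(1)]] by simp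
  then have "\<rho> k q \<noteq> Infty" using assms(2) by auto
  then have "\<rho> k \<phi> + \<rho> k q < \<rho> j \<phi> + \<rho> j q"
    using j increasing by (intro infty_add_less_le_mono) auto
  then show False using k assms(3)[OF j(1)] by simp
qed

text \<open>
  If the remainder had a smaller value than \<open>f\<close>, it would cancel against the multiple of \<open>\<phi>\<close> for
  all large indices. Since the remainder is stable, so would be that multiple.
\<close>

lemma le_lim_mod:
  assumes i: "i \<in> Field r" shows "\<rho> i f \<le> lim (f mod \<phi>)"
proof (rule ccontr)
  assume "\<not> ?thesis"
  then have n: "lim (f mod \<phi>) < \<rho> i f" by simp
  have "stable r \<rho> (f mod \<phi>)" by (rule low_stable) (rule degree_mod_lt[OF deg_pos])
  then have "eventually (\<lambda>j. \<rho> j (f mod \<phi>) = lim (f mod \<phi>) \<and> (i, j) \<in> r) (tails r)"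
    by (intro eventually_conj stableD eventually_ge i)
  then obtain k where k: "k \<in> Field r"
    "\<And>j. (k, j) \<in> r \<Longrightarrow> \<rho> j (f mod \<phi>) = lim (f mod \<phi>) \<and> (i, j) \<in> r"
    unfolding eventually_tails by blast
  have "\<rho> j (\<phi> * (f div \<phi>)) = lim (f mod \<phi>)" if j: "(k, j) \<in> r" for j
  proof -
    interpret valuation v "\<rho> j" using j by (intro member_valuation in_Field)
    have "\<rho> j (f mod \<phi>) < \<rho> j f" using k(2)[OF j] n increasing[of i j f] by auto
    then have "\<rho> j (f mod \<phi> - f) = lim (f mod \<phi>)" using diff_eq k(2)[OF j] by simp
    then show ?thesis using minus_commute[of "f mod \<phi>" f] by (simp only: minus_mod_eq_mult_div)
  qed
  moreover have "lim (f mod \<phi>) \<noteq> Infty" using n by auto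
  ultimately show False using key_multiple_grows[OF k(1)] by blast
qed

text \<open>
  Every condition concerns finitely many polynomials of degree less than \<open>deg \<phi>\<close>, which take their
  stable values at a common index. A remainder of \<open>ab\<close> with too large a value would make the
  multiple of \<open>\<phi>\<close> in \<open>ab\<close> stable.
\<close>

lemma augmentable: "augmentable v lim \<phi> \<gamma>"
proof -
  have ev: "eventually (\<lambda>i. \<rho> i a = lim a) (tails r)" if "degree a < degree \<phi>" for a
    using that by (intro stableD low_stable)
  have fin: "a = 0" if a: "degree a < degree \<phi>" "lim a = Infty" for a
  proof -
    obtain i where "i \<in> Field r" "\<rho> i a = lim a" 
      using eventually_exists[OF ev[OF a(1)]] by blast
    then show ?thesis using member_finite[of i a] a(2) by simp
  qed
  have add: "min (lim a) (lim b) \<le> lim (a + b)"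
    if "degree a < degree \<phi>" "degree b < degree \<phi>" for a b
  proof -
    have "eventually (\<lambda>i. \<rho> i a = lim a \<and> \<rho> i b = lim b \<and> \<rho> i (a + b) = lim (a + b)) (tails r)"
      using that by (intro eventually_conj ev degree_add_less)
    then obtain i where "i \<in> Field r"
      "\<rho> i a = lim a \<and> \<rho> i b = lim b \<and> \<rho> i (a + b) = lim (a + b)"
      using eventually_exists by blast
    then show ?thesis using valuation.add_ge[OF member_valuation, of i a b] by simp
  qed
  have mul: "lim (a * b mod \<phi>) = lim a + lim b \<and> lim a + lim b < \<gamma> + lim (a * b div \<phi>)"
    if ab: "degree a < degree \<phi>" "degree b < degree \<phi>" "a \<noteq> 0" "b \<noteq> 0" for a b
  proof -
    let ?c = "a * b mod \<phi>" and ?q = "a * b div \<phi>"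
    have "eventually (\<lambda>i. \<rho> i a = lim a \<and> \<rho> i b = lim b \<and> \<rho> i ?c = lim ?c \<and> \<rho> i ?q = lim ?q) (tails r)"
      using ab by (intro eventually_conj ev degree_mod_lt deg_pos degree_mult_div_less)
    then obtain k where k: "k \<in> Field r"
      "\<And>i. (k, i) \<in> r \<Longrightarrow> \<rho> i a = lim a \<and> \<rho> i b = lim b \<and> \<rho> i ?c = lim ?c \<and> \<rho> i ?q = lim ?q"
      unfolding eventually_tails by blast
    interpret k: valuation v "\<rho> k" by (rule member_valuation[OF k(1)])
    note kk = k(2)[OF reflexive[OF k(1)]]
    have V: "lim a + lim b \<noteq> Infty" using fin ab by auto
    have le: "lim a + lim b \<le> lim ?c" using le_lim_mod[OF k(1), of "a * b"] kk by simp
    have c: "lim ?c = lim a + lim b"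
    proof (rule ccontr)
      assume "\<not> ?thesis"
      then have lt: "lim a + lim b < lim ?c" using le by simp
      have "\<rho> j (\<phi> * ?q) = lim a + lim b" if j: "(k, j) \<in> r" for j
      proof -
        interpret valuation v "\<rho> j" using j by (intro member_valuation in_Field)
        have "\<rho> j (a * b - ?c) = lim a + lim b" using diff_eq[of "a * b" ?c] k(2)[OF j] lt by simp
        then show ?thesis by (simp only: minus_mod_eq_mult_div)
      qed
      then show False using key_multiple_grows[OF k(1) V] by blast
    qed
    have "lim a + lim b \<le> \<rho> k \<phi> + lim ?q"
      using k.le_key_mult[of "a * b" \<phi>] kk le by simp
    then have "lim a + lim b < \<gamma> + lim ?q"
      using above[OF k(1)] V by (cases "lim ?q = Infty") (auto intro: le_less_trans)
    then show ?thesis using c by simp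
  qed
  show ?thesis unfolding augmentable_def
    using monic deg_pos stable_limit_eq[OF const_eventually] fin add mul by simp
qed

sublocale aug: augmentable_at v lim \<phi> \<gamma>
  by unfold_locales (rule mu.field_val, rule augmentable)

lemma member_le_limit:
  assumes "i \<in> Field r" shows "\<rho> i f \<le> augment lim \<phi> \<gamma> f"
  using assms
proof (induction f arbitrary: i rule: div_induct[OF deg_pos])
  case 1 then show ?case by (simp add: aug.zero)
next
  case (2 f)
  have "stable r \<rho> (f mod \<phi>)" by (rule low_stable) (rule degree_mod_lt[OF deg_pos])
  then have "eventually (\<lambda>j. \<rho> j (f mod \<phi>) = lim (f mod \<phi>) \<and> (i, j) \<in> r) (tails r)"
    by (intro eventually_conj stableD eventually_ge 2)
  then obtain j where j: "j \<in> Field r" "\<rho> j (f mod \<phi>) = lim (f mod \<phi>)" "(i, j) \<in> r"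
    using eventually_exists by blast
  interpret valuation v "\<rho> j" by (rule member_valuation[OF j(1)])
  have "\<rho> i f \<le> \<rho> j f" by (rule increasing[OF j(3)])
  also have "\<rho> j f \<le> \<rho> j \<phi> + \<rho> j (f div \<phi>)"
    using le_key_mult[of f \<phi>] le_lim_mod[OF j(1), of f] j(2) by simp
  also have "\<dots> \<le> \<gamma> + augment lim \<phi> \<gamma> (f div \<phi>)"
    using 2 above[OF j(1)] j(1) by (intro add_mono) auto
  finally show ?case using le_lim_mod[OF 2(3), of f] by (subst aug.rec) simp
qed

end


section \<open>Truncations\<close>

text \<open>
  Written \<open>\<mu>\<^sub>Q\<close> in the introduction. It is a valuation only for suitable \<open>Q\<close>, which the locale
  \<open>truncation\<close> singles out.
\<close>

definition truncated :: "('k::field, 'g::linordered_ab_group_add) pmap \<Rightarrow> 'k poly \<Rightarrow> ('k, 'g) pmap" where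
  "truncated w Q = augment w Q (w Q)"

context valuation
begin

lemma truncated_low: "degree a < degree Q \<Longrightarrow> truncated \<mu> Q a = \<mu> a"
  unfolding truncated_def by (rule augment_low) simp_all

lemma truncated_key: "degree Q > 0 \<Longrightarrow> truncated \<mu> Q Q = \<mu> Q"
  using augment_mult_key[of Q \<mu> "\<mu> Q" 1] augment_low[of 1 Q \<mu> "\<mu> Q"]
  by (simp add: truncated_def)

lemma truncated_le: "degree Q > 0 \<Longrightarrow> truncated \<mu> Q f \<le> \<mu> f"
  unfolding truncated_def by (rule augment_le_valuation) simp_all

lemma truncated_mono:
  assumes "key_valuation v (truncated \<mu> Q') Q'" "lead_coeff Q = 1" "degree Q = degree Q'" "\<mu> Q \<le> \<mu> Q'"
  shows "truncated \<mu> Q f \<le> truncated \<mu> Q' f"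
proof -
  interpret T': key_valuation v "truncated \<mu> Q'" Q' by fact
  have "degree (Q - Q') < degree Q"
    using assms T'.monic T'.deg_pos by (intro monic_diff_degree) auto
  then have "\<mu> Q \<le> truncated \<mu> Q' (Q - Q')"
    using assms ge_diff[of "\<mu> Q" Q Q'] by (simp add: truncated_low)
  then have "\<mu> Q \<le> truncated \<mu> Q' (Q' + (Q - Q'))"
    using assms(4) T'.deg_pos by (intro T'.ge_add) (simp add: truncated_key)
  then have "\<mu> Q \<le> truncated \<mu> Q' Q" by simp
  then show ?thesis
    unfolding truncated_def[of \<mu> Q]
    using T'.deg_pos assms(3) by (intro T'.augment_le_valuation) (simp_all add: truncated_low)
qed

end

locale truncation = w: valuation v w + T: key_valuation v "truncated w Q" Q
  for v :: "'k::field \<Rightarrow> 'g::linordered_ab_group_add infty" and w :: "('k, 'g) pmap"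
    and Q :: "'k poly"
begin

abbreviation term_value :: "'k poly \<Rightarrow> nat \<Rightarrow> 'g infty" where
  "term_value f i \<equiv> w (coeff (expansion Q f) i) + nat_mult i (w Q)"

lemma truncated_coeff: "truncated w Q (coeff (expansion Q f) i * Q ^ i) = term_value f i"
  by (simp add: w.truncated_key w.truncated_low T.deg_pos coeff_expansion_less)

lemma term_value_ge: "truncated w Q f \<le> term_value f i"
  unfolding truncated_def by (rule augment_le) simp

lemma expansion_degree_eq:
  assumes "truncated w Q f \<noteq> Infty"
  shows "expansion_degree (truncated w Q) Q f = Max {i. term_value f i = truncated w Q f}"
    and "finite {i. term_value f i = truncated w Q f}"
    and "{i. term_value f i = truncated w Q f} \<noteq> {}"
proof -
  have sub: "i \<le> degree (expansion Q f)" if "term_value f i = truncated w Q f" for i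
    using that assms by (metis w.zero add_eq_Infty coeff_eq_0 not_le)
  have eq: "{i. i \<le> degree (expansion Q f) \<and> truncated w Q (coeff (expansion Q f) i * Q ^ i) = truncated w Q f}
      = {i. term_value f i = truncated w Q f}"
    unfolding truncated_coeff using sub by auto
  show "expansion_degree (truncated w Q) Q f = Max {i. term_value f i = truncated w Q f}"
    unfolding expansion_degree_def eq by (rule refl)
  show "finite {i. term_value f i = truncated w Q f}"
    by (rule finite_subset[of _ "{..degree (expansion Q f)}"]) (use sub in auto)
  show "{i. term_value f i = truncated w Q f} \<noteq> {}"
  proof -
    obtain i where "truncated w Q f = term_value f i"
      unfolding truncated_def by (rule augment_attained)
    then show ?thesis by auto
  qed
qed

lemma expansion_degree_add:
  assumes "truncated w Q f < truncated w Q a"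
  shows "expansion_degree (truncated w Q) Q (f + a) = expansion_degree (truncated w Q) Q f"
proof -
  let ?T = "truncated w Q"
  have T: "?T (f + a) = ?T f" using assms by (rule T.add_eq)
  have fin: "?T f \<noteq> Infty" using assms by auto
  have "term_value (f + a) i = ?T f \<longleftrightarrow> term_value f i = ?T f" for i
  proof -
    let ?f = "coeff (expansion Q f) i * Q ^ i" and ?a = "coeff (expansion Q a) i * Q ^ i"
    have a: "?T f < ?T ?a"
      unfolding truncated_coeff using assms term_value_ge[of a i] by (rule less_le_trans)
    have s: "coeff (expansion Q (f + a)) i * Q ^ i = ?f + ?a"
      by (simp add: expansion_add T.deg_pos distrib_right)
    have "?T f \<le> ?T ?f" unfolding truncated_coeff by (rule term_value_ge)
    then consider "?T ?f = ?T f" | "?T f < ?T ?f" by (auto simp: le_less)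
    then have "?T (?f + ?a) = ?T f \<longleftrightarrow> ?T ?f = ?T f"
    proof cases
      case 1
      then show ?thesis using T.add_eq[of ?f ?a] a by (simp only:)
    next
      case 2
      then have "?T f < ?T (?f + ?a)" using a by (rule T.gt_add)
      with 2 show ?thesis by (simp only: less_imp_neq[symmetric] neq_iff)
    qed
    then show ?thesis unfolding s[symmetric] unfolding truncated_coeff .
  qed
  then show ?thesis using T fin by (simp add: expansion_degree_eq)
qed

end

text \<open>
  Let \<open>d\<close> be the degree for \<open>Q\<close> and split \<open>f = g + h\<close>, where \<open>g\<close> collects the terms of the
  \<open>Q\<close>-expansion up to \<open>d\<close>, so that \<open>h\<close> has larger value than \<open>f\<close>. For reasons of degree \<open>g\<close> has no
  terms beyond \<open>d\<close> in the \<open>Q'\<close>-expansion either; so those terms of \<open>f\<close> come from \<open>h\<close> and are not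
  minimal when \<open>Q'\<close> is given the value \<open>w(Q)\<close>. Raising the value of \<open>Q'\<close> to \<open>w(Q')\<close> raises
  the terms of high index most, so they do not become minimal.
\<close>

lemma expansion_degree_antimono:
  assumes "truncation v w Q" "truncation v w Q'" "degree Q = degree Q'" "w Q \<le> w Q'"
    "w Q' \<noteq> Infty" "f \<noteq> 0"
  shows "expansion_degree (truncated w Q') Q' f \<le> expansion_degree (truncated w Q) Q f"
proof -
  interpret Q: truncation v w Q by fact
  interpret Q': truncation v w Q' by fact
  let ?T = "truncated w Q" and ?T' = "truncated w Q'"
  have pos: "degree Q > 0" "degree Q' > 0" by (rule Q.T.deg_pos Q'.T.deg_pos)+
  have TQ: "?T Q = w Q" "?T' Q' = w Q'" by (simp_all add: Q.w.truncated_key pos)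
  have fin: "w Q \<noteq> Infty" using assms(4,5) by auto
  have Tf: "?T f \<noteq> Infty" using Q.T.eq_0_of_Infty[of f] TQ fin assms(6) by simp
  have T'f: "?T' f \<noteq> Infty" using Q'.T.eq_0_of_Infty[of f] TQ assms(5,6) by simp
  define d where "d = expansion_degree ?T Q f"
  have above_d: "?T f < Q.term_value f l" if "d < l" for l
  proof -
    have "l \<notin> {i. Q.term_value f i = ?T f}"
      using Max_ge[OF Q.expansion_degree_eq(2)[OF Tf], of l] that
      unfolding d_def Q.expansion_degree_eq(1)[OF Tf] by auto
    then show ?thesis using Q.term_value_ge[of f l] by auto
  qed
  let ?P = "Q ^ Suc d"
  let ?g = "f mod ?P" and ?h = "?P * (f div ?P)"
  have h: "?T f < ?T ?h"
  proof -
    obtain i where "?T (f div ?P) = Q.term_value (f div ?P) i"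
      unfolding truncated_def by (rule augment_attained)
    then have "?T ?h = Q.term_value f (i + Suc d)"
      by (simp only: Q.T.mult Q.T.power TQ coeff_expansion_div_power[OF pos(1)] nat_mult_add)
        (simp add: ac_simps)
    then show ?thesis using above_d[of "i + Suc d"] by simp
  qed
  have TT': "?T k \<le> ?T' k" for k
    by (rule Q.w.truncated_mono) (use assms Q'.T.key_valuation_axioms Q.T.monic in auto)
  \<comment> \<open>This and \<open>TQ'_le\<close> bound the truncation at \<open>Q\<close> by every term of the \<open>Q'\<close>-expansion.\<close>
  have le_mod: "?T k \<le> ?T (k mod Q')" for k
  proof (cases "w Q = w Q'")
    case True
    have "?T' k \<le> ?T k" for k
      by (rule Q.w.truncated_mono)
        (use assms Q.T.key_valuation_axioms Q'.T.monic True in auto)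
    then have "?T = ?T'" using TT' by (intro ext antisym)
    then show ?thesis using Q'.T.le_mod by simp
  next
    case False
    have "?T Q' \<le> ?T Q" by (rule Q.T.monic_value_le[OF Q'.T.monic assms(3)[symmetric]])
    then have "?T Q' < ?T' Q'" using TQ False assms(4) by simp
    have low_finite: "a = 0" if "degree a < degree Q'" "w a = Infty" for a
      using Q'.T.finite_low[of a] that by (simp add: Q.w.truncated_low)
    from \<open>?T Q' < ?T' Q'\<close> interpret tangent v ?T ?T' Q'
      using TT' Q'.T.monic pos assms(3)
      by unfold_locales (auto simp: Q.w.truncated_low dest: low_finite)
    show ?thesis by (rule le_mod)
  qed
  have TQ': "w Q \<le> ?T Q'"
  proof -
    have "degree (Q' - Q) < degree Q'"
      by (rule monic_diff_degree[OF Q'.T.monic Q.T.monic assms(3)[symmetric] pos(2)])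
    then have "degree (Q' - Q) < degree Q" by (simp only: assms(3))
    then have "w Q \<le> ?T (Q' - Q)"
      using assms(4) Q.w.ge_diff[of "w Q" Q' Q] by (simp add: Q.w.truncated_low)
    then show ?thesis using Q.T.ge_add[of "w Q" "Q' - Q" Q] TQ by simp
  qed
  have TQ'_le: "?T Q' \<le> w Q"
    using Q.T.monic_value_le[OF Q'.T.monic assms(3)[symmetric]] by (simp only: TQ)
  have bound: "?T k \<le> w (coeff (expansion Q' k) l) + nat_mult l (w Q)" for k l
  proof (induction l arbitrary: k)
    case 0
    have "?T (k mod Q') = w (k mod Q')"
      using degree_mod_lt[OF pos(2), of k] assms(3) by (intro Q.w.truncated_low) simp
    then show ?case using le_mod[of k] by (simp add: expansion_rec[OF pos(2), of k])
  next
    case (Suc l)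
    have "?T k \<le> ?T Q' + ?T (k div Q')" using Q.T.le_key_mult[OF le_mod[of k]] by simp
    also have "\<dots> \<le> w Q + (w (coeff (expansion Q' (k div Q')) l) + nat_mult l (w Q))"
      by (intro add_mono TQ'_le Suc)
    finally show ?case by (simp add: expansion_rec[OF pos(2), of k] ac_simps)
  qed
  have high: "?T f < w (coeff (expansion Q' f) l) + nat_mult l (w Q)" if "d < l" for l
  proof -
    have "degree ?g < Suc d * degree Q'"
    proof -
      have "degree ?P = Suc d * degree Q'"
        unfolding assms(3)[symmetric] by (rule degree_power_eq) (rule Q.T.aug.nonzero)
      then show ?thesis using degree_mod_lt[of ?P f] pos(2) by simp
    qed
    then have "coeff (expansion Q' ?g) l = 0"
      using that by (rule coeff_expansion_eq_0[OF pos(2) _ Suc_leI])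
    moreover have "expansion Q' f = expansion Q' ?h + expansion Q' ?g"
      using expansion_add[OF pos(2), of ?h ?g] by simp
    ultimately show ?thesis using less_le_trans[OF h bound[of ?h l]] by simp
  qed
  \<comment> \<open>A minimal term of the \<open>Q'\<close>-expansion for the old value \<open>w(Q)\<close>, for comparison with the later terms.\<close>
  obtain k where k: "w (coeff (expansion Q' f) k) + nat_mult k (w Q) \<le> ?T f"
  proof -
    obtain k where "augment w Q' (w Q) f = w (coeff (expansion Q' f) k) + nat_mult k (w Q)"
      by (rule augment_attained)
    moreover have "augment w Q' (w Q) f \<le> ?T f"
      using pos TQ' assms(3) by (intro Q.T.augment_le_valuation) (simp_all add: Q.w.truncated_low)
    ultimately show ?thesis using that by simp
  qed
  have kd: "k \<le> d" using high[of k] k by (cases "k \<le> d") auto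
  have high': "?T' f < Q'.term_value f l" if l: "d < l" for l
  proof -
    obtain e where e: "l = k + e" using kd l le_Suc_ex[of k l] by auto
    let ?fk = "w (coeff (expansion Q' f) k)" and ?fl = "w (coeff (expansion Q' f) l)"
    have "?fk + nat_mult k (w Q) < (?fl + nat_mult e (w Q)) + nat_mult k (w Q)"
      using le_less_trans[OF k high[OF l]] by (simp add: e nat_mult_add ac_simps)
    then have "?fk < ?fl + nat_mult e (w Q)" using fin by simp
    also have "\<dots> \<le> ?fl + nat_mult e (w Q')" by (intro add_left_mono nat_mult_mono assms)
    finally have "?fk + nat_mult k (w Q') < (?fl + nat_mult e (w Q')) + nat_mult k (w Q')"
      using assms(5) by simp
    then show ?thesis
      using le_less_trans[OF Q'.term_value_ge[of f k]] by (simp add: e nat_mult_add ac_simps)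
  qed
  have "Max {i. Q'.term_value f i = ?T' f} \<le> d"
  proof (rule Max.boundedI[OF Q'.expansion_degree_eq(2,3)[OF T'f]])
    fix i assume "i \<in> {i. Q'.term_value f i = ?T' f}"
    then show "i \<le> d" using high'[of i] by (cases "i \<le> d") auto
  qed
  then show ?thesis unfolding d_def Q'.expansion_degree_eq(1)[OF T'f] .
qed


section \<open>Comparing limit steps\<close>

definition near :: "('k::field, 'g::linordered_ab_group_add) pmap \<Rightarrow> nat \<Rightarrow> 'g infty \<Rightarrow> 'k poly set" where
  "near w m \<delta> = {Q. lead_coeff Q = 1 \<and> degree Q = m \<and> \<delta> < w Q}"

lemma nearD:
  assumes "Q \<in> near w m \<delta>"
  shows "lead_coeff Q = 1" "degree Q = m" "\<delta> < w Q"
  using assms unfolding near_def by blast+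

text \<open>
  What a limit step leaves visible in the final valuation \<open>w\<close>: \<open>m\<close> is the degree before the step,
  \<open>near w m \<delta>\<close> its tangent direction and \<open>\<phi>\<close> a minimal polynomial of the valuation after it. The
  continuous family is eliminated, since it is cofinal among the truncations: stable
  values become values attained by a truncation (\<open>exact\<close>), and instability of \<open>\<phi>\<close> becomes \<open>grows\<close>.
\<close>

locale limit_direction = w: valuation v w
  for v :: "'k::field \<Rightarrow> 'g::linordered_ab_group_add infty" and w :: "('k, 'g) pmap" +
  fixes m :: nat and \<delta> :: "'g infty" and \<phi> :: "'k poly"
  assumes monic: "lead_coeff \<phi> = 1" and deg_pos: "degree \<phi> > 0"
    and key: "Q \<in> near w m \<delta> \<Longrightarrow> key_valuation v (truncated w Q) Q"
    and no_max: "lead_coeff Q = 1 \<Longrightarrow> degree Q = m \<Longrightarrow> \<exists>Q'. lead_coeff Q' = 1 \<and> degree Q' = m \<and> w Q < w Q'"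
    and exact: "degree f < degree \<phi> \<Longrightarrow> \<exists>Q\<in>near w m \<delta>. truncated w Q f = w f"
    and grows: "Q \<in> near w m \<delta> \<Longrightarrow> \<exists>Q'\<in>near w m \<delta>. truncated w Q \<phi> < truncated w Q' \<phi>"
begin

lemma near_truncation: "Q \<in> near w m \<delta> \<Longrightarrow> truncation v w Q"
  using key by (simp add: truncation_def w.valuation_axioms)

lemma near_mono:
  assumes "Q \<in> near w m \<delta>" "Q' \<in> near w m \<delta>" "w Q \<le> w Q'"
  shows "truncated w Q f \<le> truncated w Q' f"
  using assms by (intro w.truncated_mono key) (auto simp: near_def)

lemma near_le: "Q \<in> near w m \<delta> \<Longrightarrow> truncated w Q f \<le> w f"
  using truncation.axioms(2)[OF near_truncation] by (intro w.truncated_le key_valuation.deg_pos)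

lemma near_finite: "Q \<in> near w m \<delta> \<Longrightarrow> w Q \<noteq> Infty"
  using no_max[of Q] by (auto simp: near_def)

lemma near_up: "Q \<in> near w m \<delta> \<Longrightarrow> Q' \<in> near w m \<delta>' \<Longrightarrow> w Q \<le> w Q' \<Longrightarrow> Q' \<in> near w m \<delta>"
  by (auto simp: near_def)

lemma near_exact:
  assumes "Q \<in> near w m \<delta>" "Q' \<in> near w m \<delta>" "w Q \<le> w Q'" "truncated w Q f = w f"
  shows "truncated w Q' f = w f"
  using near_mono[OF assms(1-3), of f] near_le[OF assms(2), of f] assms(4) by simp

end

text \<open>
  Each tangent direction is closed under passing to larger values, so the one with the larger value
  of two polynomials lies in both.
\<close>

lemma near_max:
  assumes "Q \<in> near w m \<delta>" "Q' \<in> near w m \<delta>'"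
  shows "\<exists>P\<in>near w m \<delta> \<inter> near w m \<delta>'. w Q \<le> w P \<and> w Q' \<le> w P"
  using assms by (cases "w Q \<le> w Q'") (auto simp: near_def)

text \<open>
  If \<open>\<phi>\<close> had smaller degree than \<open>\<phi>'\<close>, some truncation would give \<open>\<phi>\<close> its full value, and there is
  no room for further growth.
\<close>

lemma limit_direction_degree_le:
  assumes "limit_direction v w m \<delta> \<phi>" "limit_direction v w m \<delta>' \<phi>'"
  shows "degree \<phi>' \<le> degree \<phi>"
proof (rule ccontr)
  interpret D: limit_direction v w m \<delta> \<phi> by fact
  interpret D': limit_direction v w m \<delta>' \<phi>' by fact
  assume "\<not> ?thesis"
  then obtain Q where Q: "Q \<in> near w m \<delta>'" "truncated w Q \<phi> = w \<phi>"
    using D'.exact[of \<phi>] by auto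
  obtain Q1 where "Q1 \<in> near w m \<delta>" using D.exact[of 0] D.deg_pos by auto
  then obtain P where P: "P \<in> near w m \<delta>" "P \<in> near w m \<delta>'" "w Q \<le> w P"
    using near_max Q(1) by blast
  have "truncated w P \<phi> = w \<phi>" by (rule D'.near_exact[OF Q(1) P(2,3) Q(2)])
  moreover obtain P' where "P' \<in> near w m \<delta>" "truncated w P \<phi> < truncated w P' \<phi>"
    using D.grows[OF P(1)] by blast
  ultimately show False using D.near_le[of P' \<phi>] by simp
qed

lemma limit_direction_degree_eq:
  assumes "limit_direction v w m \<delta> \<phi>" "limit_direction v w m \<delta>' \<phi>'"
  shows "degree \<phi> = degree \<phi>'"
  using limit_direction_degree_le assms by (intro antisym)

text \<open>
  Choose \<open>P\<close> in both tangent directions, above \<open>Q\<close> and so large that the truncations of \<open>\<phi>' - \<phi>\<close> have become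
  constant. If \<open>\<phi>\<close> reached that constant value, then it would eventually exceed it, and \<open>\<phi>'\<close> would
  become constant, against \<open>grows\<close>. So \<open>\<phi>' - \<phi>\<close> is negligible at \<open>P\<close>.
\<close>

lemma limit_direction_expansion_degree_le:
  assumes "limit_direction v w m \<delta> \<phi>" "limit_direction v w m \<delta>' \<phi>'" "Q \<in> near w m \<delta>"
  shows "\<exists>P\<in>near w m \<delta>'. expansion_degree (truncated w P) P \<phi>' \<le> expansion_degree (truncated w Q) Q \<phi>"
proof -
  interpret D: limit_direction v w m \<delta> \<phi> by fact
  interpret D': limit_direction v w m \<delta>' \<phi>' by fact
  let ?a = "\<phi>' - \<phi>"
  have eq: "degree \<phi>' = degree \<phi>" by (rule limit_direction_degree_eq[OF assms(2,1)])
  have "degree ?a < degree \<phi>"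
    using monic_diff_degree[OF D'.monic D.monic eq D'.deg_pos] by (simp only: eq)
  then obtain Q1 where Q1: "Q1 \<in> near w m \<delta>" "truncated w Q1 ?a = w ?a" using D.exact by blast
  obtain Q2 where Q2: "Q2 \<in> near w m \<delta>'" using D'.exact[of 0] D'.deg_pos by auto
  obtain R where R: "R \<in> near w m \<delta>" "R \<in> near w m \<delta>'" "w Q \<le> w R"
    using near_max[OF assms(3) Q2] by blast
  obtain P where P: "P \<in> near w m \<delta>" "w R \<le> w P" "w Q1 \<le> w P"
    using near_max[OF R(1) Q1(1)] by blast
  have P': "P \<in> near w m \<delta>'" by (rule D'.near_up[OF R(2) P(1,2)])
  have a: "truncated w S ?a = w ?a" if "S \<in> near w m \<delta>" "w P \<le> w S" for S
    using that P(3) by (intro D.near_exact[OF Q1(1) _ _ Q1(2)]) auto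
  have lt: "truncated w P \<phi> < w ?a"
  proof (rule ccontr)
    assume n: "\<not> ?thesis"
    obtain S1 where S1: "S1 \<in> near w m \<delta>" "truncated w P \<phi> < truncated w S1 \<phi>"
      using D.grows[OF P(1)] by blast
    obtain S where S: "S \<in> near w m \<delta>" "w P \<le> w S" "w S1 \<le> w S"
      using near_max[OF P(1) S1(1)] by blast
    have S': "S \<in> near w m \<delta>'" by (rule D'.near_up[OF P' S(1,2)])
    \<comment> \<open>Once the value of \<open>\<phi>\<close> exceeds that of \<open>a\<close>, the value of \<open>\<phi>' = a + \<phi>\<close> is frozen at \<open>w(a)\<close>.\<close>
    have const: "truncated w U \<phi>' = w ?a" if U: "U \<in> near w m \<delta>" "w S \<le> w U" for U
    proof -
      interpret U: truncation v w U by (rule D.near_truncation[OF U(1)])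
      have "w S1 \<le> w U" using S(3) U(2) by simp
      then have "w ?a < truncated w U \<phi>"
        using n S1(2) D.near_mono[OF S1(1) U(1), of \<phi>] by auto
      then have "truncated w U (?a + \<phi>) = truncated w U ?a"
        using a[OF U(1)] S(2) U(2) by (intro U.T.add_eq) auto
      then show ?thesis using a[OF U(1)] S(2) U(2) by auto
    qed
    obtain V where V: "V \<in> near w m \<delta>'" "truncated w S \<phi>' < truncated w V \<phi>'"
      using D'.grows[OF S'] by blast
    obtain U where U: "U \<in> near w m \<delta>" "U \<in> near w m \<delta>'" "w S \<le> w U" "w V \<le> w U"
      using near_max[OF S(1) V(1)] by blast
    show False
      using V(2) const[OF S(1)] const[OF U(1,3)] D'.near_mono[OF V(1) U(2,4), of \<phi>'] by auto
  qed
  interpret P: truncation v w P by (rule D.near_truncation[OF P(1)])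
  have "expansion_degree (truncated w P) P (\<phi> + ?a) = expansion_degree (truncated w P) P \<phi>"
    using lt a[OF P(1)] by (intro P.expansion_degree_add) simp
  also have "\<dots> \<le> expansion_degree (truncated w Q) Q \<phi>"
  proof (rule expansion_degree_antimono)
    show "w Q \<le> w P" using R(3) P(2) by simp
    show "\<phi> \<noteq> 0" using D.deg_pos by auto
  qed (use D.near_truncation D.near_finite assms(3) P(1) in \<open>auto simp: near_def\<close>)
  finally show ?thesis using P' by auto
qed

lemma limit_direction_defect_eq:
  assumes "limit_direction v w m \<delta> \<phi>" "limit_direction v w m \<delta>' \<phi>'"
  shows "(LEAST d. \<exists>Q\<in>near w m \<delta>. d = expansion_degree (truncated w Q) Q \<phi>) =
    (LEAST d. \<exists>Q\<in>near w m \<delta>'. d = expansion_degree (truncated w Q) Q \<phi>')"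
proof -
  have le: "(LEAST d. \<exists>Q\<in>near w m \<delta>'. d = expansion_degree (truncated w Q) Q \<phi>')
     \<le> (LEAST d. \<exists>Q\<in>near w m \<delta>. d = expansion_degree (truncated w Q) Q \<phi>)"
    (is "Least ?R' \<le> Least ?R")
    if D: "limit_direction v w m \<delta> \<phi>" "limit_direction v w m \<delta>' \<phi>'" for \<delta> \<phi> \<delta>' \<phi>'
  proof -
    obtain Q where "Q \<in> near w m \<delta>"
      using limit_direction.exact[OF D(1), of 0] limit_direction.deg_pos[OF D(1)] by auto
    then have "?R (Least ?R)" by (intro LeastI_ex[of ?R]) blast
    then obtain Q where Q: "Q \<in> near w m \<delta>" "Least ?R = expansion_degree (truncated w Q) Q \<phi>"
      by blast
    obtain P where P: "P \<in> near w m \<delta>'"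
      "expansion_degree (truncated w P) P \<phi>' \<le> expansion_degree (truncated w Q) Q \<phi>"
      using limit_direction_expansion_degree_le[OF D Q(1)] by blast
    have "Least ?R' \<le> expansion_degree (truncated w P) P \<phi>'"
      by (rule Least_le) (use P(1) in blast)
    then show ?thesis using P(2) Q(2) by simp
  qed
  show ?thesis using le[OF assms] le[OF assms(2,1)] by (rule antisym[rotated])
qed


section \<open>Tangent degrees\<close>

lemma tangent_directionD:
  assumes "Q \<in> tangent_direction \<mu> \<nu>"
  shows "lead_coeff Q = 1" "\<mu> Q < \<nu> Q" "degree Q = tangent_degree \<mu> \<nu>"
  using assms unfolding tangent_direction_def by blast+

lemma tangent_degree_le: "lead_coeff g = 1 \<Longrightarrow> \<mu> g < \<nu> g \<Longrightarrow> tangent_degree \<mu> \<nu> \<le> degree g"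
  unfolding tangent_degree_def by (rule Least_le) blast

text \<open>The tangent degree only speaks of monic polynomials; the others are scaled.\<close>

lemma below_tangent_degree:
  assumes "valuation v \<mu>" "valuation v \<nu>" "\<And>f. \<mu> f \<le> \<nu> f" "degree f < tangent_degree \<mu> \<nu>"
  shows "\<mu> f = \<nu> f"
proof (rule ccontr)
  interpret \<mu>: valuation v \<mu> by fact
  interpret \<nu>: valuation v \<nu> by fact
  assume "\<mu> f \<noteq> \<nu> f"
  then have less: "\<mu> f < \<nu> f" using assms(3)[of f] by simp
  then have "f \<noteq> 0" by auto
  let ?c = "inverse (lead_coeff f)"
  have c: "?c \<noteq> 0" using \<open>f \<noteq> 0\<close> by simp
  have "lead_coeff (smult ?c f) = 1" using \<open>f \<noteq> 0\<close> by simp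
  moreover have "\<mu> (smult ?c f) < \<nu> (smult ?c f)"
    unfolding \<mu>.smult \<nu>.smult using less c by (simp only: infty_cancel \<mu>.v_eq_Infty not_False_eq_True)
  ultimately have "tangent_degree \<mu> \<nu> \<le> degree (smult ?c f)" by (rule tangent_degree_le)
  then show False using assms(4) c by simp
qed

lemma tangent_degree_eqI:
  assumes "lead_coeff g = 1" "\<mu> g < \<nu> g" "\<And>f. degree f < degree g \<Longrightarrow> \<mu> f = \<nu> f"
  shows "tangent_degree \<mu> \<nu> = degree g"
  unfolding tangent_degree_def
proof (rule Least_equality)
  fix d assume "\<exists>f. lead_coeff f = 1 \<and> \<mu> f < \<nu> f \<and> degree f = d"
  then show "degree g \<le> d" using assms(3) by (metis less_irrefl not_le)
qed (use assms in blast)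

lemma tangent_direction_nonempty:
  assumes "lead_coeff g = 1" "\<mu> g < \<nu> g"
  obtains Q where "Q \<in> tangent_direction \<mu> \<nu>"
proof -
  have "\<exists>Q. lead_coeff Q = 1 \<and> \<mu> Q < \<nu> Q \<and> degree Q = tangent_degree \<mu> \<nu>"
    unfolding tangent_degree_def by (rule LeastI_ex) (use assms in blast)
  then show ?thesis using that by (auto simp: tangent_direction_def)
qed

lemma defect_eq:
  assumes "\<And>Q. Q \<in> tangent_direction \<mu> \<nu> \<Longrightarrow> augment \<mu> Q (\<nu> Q) = T Q"
  shows "defect \<mu> \<nu> = (LEAST d. \<exists>Q\<in>tangent_direction \<mu> \<nu>.
    d = expansion_degree (T Q) Q (SOME \<phi>. \<phi> \<in> minimal_polys \<nu>))"
  unfolding defect_def Let_def using assms by (metis (mono_tags, lifting))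


section \<open>Ordinary steps\<close>

locale ordinary_step = mu: key_valuation v \<mu> \<phi>
  for v :: "'k::field \<Rightarrow> 'g::linordered_ab_group_add infty"
    and \<mu> :: "('k, 'g) pmap" and \<phi> :: "'k poly" +
  fixes \<psi> :: "'k poly" and \<gamma> :: "'g infty" and \<nu> :: "('k, 'g) pmap"
  assumes augmentation: "ordinary_augmentation \<mu> \<psi> \<gamma> \<nu>"
    and degree_less_tangent: "val_degree \<mu> < tangent_degree \<mu> \<nu>"
begin

lemma KP: "\<psi> \<in> KP \<mu>" and less: "\<mu> \<psi> < \<gamma>" and nu_eq: "\<nu> = augment \<mu> \<psi> \<gamma>"
  using augmentation by (simp_all add: ordinary_augmentation_def)

sublocale base: augmentable_at v \<mu> \<psi> \<gamma>
  by unfold_locales (rule mu.field_val, rule mu.KP_augmentable[OF KP less])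

sublocale nu: key_valuation v \<nu> \<psi>
  unfolding nu_eq by (rule base.key_valuation_augment)

lemma le: "\<mu> f \<le> \<nu> f"
  unfolding nu_eq by (rule mu.KP_augment_ge[OF KP less])

lemma low_eq: "degree f < degree \<psi> \<Longrightarrow> \<mu> f = \<nu> f"
  unfolding nu_eq by (rule base.low[symmetric])

lemma key_less: "\<mu> \<psi> < \<nu> \<psi>"
  unfolding nu_eq base.aug_key by (rule less)

lemma tangent_degree_eq: "tangent_degree \<mu> \<nu> = degree \<psi>"
  using nu.monic key_less low_eq by (rule tangent_degree_eqI)

lemma degree_less: "degree \<phi> < degree \<psi>"
  using degree_less_tangent by (simp only: tangent_degree_eq mu.val_degree_eq)

text \<open>
  A minimal polynomial of \<open>\<nu>\<close> has the degree of \<open>Q\<close>, so its \<open>Q\<close>-expansion is \<open>a + Q\<close>. The summand \<open>a\<close>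
  is the difference of two polynomials of value at least \<open>\<nu>(Q)\<close>, so that the term \<open>Q\<close> is minimal.
\<close>

lemma defect_eq_1: "defect \<mu> \<nu> = 1"
proof -
  define p where "p = (SOME p. p \<in> minimal_polys \<nu>)"
  have p: "p \<in> minimal_polys \<nu>" unfolding p_def using nu.key_in_minimal_polys by (rule someI)
  have E: "expansion_degree (augment \<mu> Q (\<nu> Q)) Q p = 1" if Q: "Q \<in> tangent_direction \<mu> \<nu>" for Q
  proof -
    have Qm: "lead_coeff Q = 1" "\<mu> Q < \<nu> Q" and Qd: "degree Q = degree \<psi>"
      using tangent_directionD[OF Q] by (simp_all only: tangent_degree_eq)
    have pos: "degree Q > 0" using nu.deg_pos by (simp only: Qd)
    have low: "\<mu> a = \<nu> a" "\<nu> a = Infty \<Longrightarrow> a = 0" if "degree a < degree Q" for a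
      using that low_eq[of a] nu.finite_low[of a] by (simp_all add: Qd)
    interpret tangent v \<mu> \<nu> Q
      using le Qm pos low by unfold_locales
    have T: "augment \<mu> Q (\<nu> Q) = augment \<nu> Q (\<nu> Q)"
      by (rule augment_cong[OF pos low(1)])
    let ?T = "augment \<nu> Q (\<nu> Q)" and ?a = "p - Q"
    have pd: "degree p = degree Q" by (simp only: nu.minimal_polysD(2)[OF p] Qd)
    have da: "degree ?a < degree Q"
      using monic_diff_degree[OF nu.minimal_polysD(1)[OF p] Qm(1) pd] pos by (simp only: pd)
    have "\<nu> Q \<le> \<nu> \<psi>" by (rule nu.monic_value_le[OF Qm(1) Qd])
    then have a: "\<nu> Q \<le> \<nu> ?a"
      using nu.value_minimal_poly[OF p] nu.ge_diff[of "\<nu> Q" p Q] by simp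
    have "is_expansion Q p [:?a, 1:]"
      using da pos by (auto simp: is_expansion_def coeff_pCons split: nat.split)
    then have X: "expansion Q p = [:?a, 1:]" by (rule expansionI[OF pos])
    have "?T (?a + Q) = \<nu> Q"
    proof -
      have "?T (?a + Q) = min (?T ?a) (?T Q + ?T 1)"
        using trunc.min_formula[of "?a + Q"] by (simp only: add_self_div_mod[OF da])
      then show ?thesis using a aug.low[OF da] aug.aug_key by (simp add: min_def)
    qed
    then have "?T p = \<nu> Q" by simp
    then have "1 \<in> {i. i \<le> degree (expansion Q p) \<and> ?T (coeff (expansion Q p) i * Q ^ i) = ?T p}"
      unfolding X using aug.aug_key by simp
    moreover have "{i. i \<le> degree (expansion Q p) \<and> ?T (coeff (expansion Q p) i * Q ^ i) = ?T p} \<subseteq> {..1}"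
      unfolding X by auto
    ultimately show ?thesis unfolding T expansion_degree_def
      by (intro Max_eqI) (auto intro: finite_subset)
  qed
  obtain Q where "Q \<in> tangent_direction \<mu> \<nu>"
    using nu.monic key_less by (rule tangent_direction_nonempty)
  then show ?thesis
    unfolding defect_def Let_def p_def[symmetric] using E by (intro Least_equality) force+
qed

end


section \<open>Limit steps\<close>

locale limit_step = mu: key_valuation v \<mu> \<phi>
  for v :: "'k::field \<Rightarrow> 'g::linordered_ab_group_add infty"
    and \<mu> :: "('k, 'g) pmap" and \<phi> :: "'k poly" +
  fixes r :: "'i rel" and \<rho> :: "'i \<Rightarrow> ('k, 'g) pmap"
    and \<psi> :: "'k poly" and \<gamma> :: "'g infty" and \<nu> :: "('k, 'g) pmap"
  assumes continuous: "continuous_augmentations v \<mu> r \<rho>"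
    and augmentation: "limit_augmentation r \<rho> \<psi> \<gamma> \<nu>"
    and degree_eq_tangent: "val_degree \<mu> = tangent_degree \<mu> \<nu>"
    and tangent_less: "tangent_degree \<mu> \<nu> < val_degree \<nu>"
    and key_not_tangent: "\<phi> \<notin> tangent_direction \<mu> \<nu>"
begin

lemma nu_eq: "\<nu> = augment (stable_limit r \<rho>) \<psi> \<gamma>"
  using augmentation by (simp add: limit_augmentation_def)

sublocale base: limit_augmentable v \<mu> r \<rho> \<psi> \<gamma>
  using continuous augmentation by unfold_locales (auto simp: limit_augmentation_def)

sublocale nu: key_valuation v \<nu> \<psi>
  unfolding nu_eq by (rule base.aug.key_valuation_augment)

lemma member_le: "i \<in> Field r \<Longrightarrow> \<rho> i f \<le> \<nu> f"
  unfolding nu_eq by (rule base.member_le_limit)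

lemma le: "\<mu> f \<le> \<nu> f"
proof -
  obtain i where "i \<in> Field r" using base.nonempty by blast
  then show ?thesis using base.member_ge[of i f] member_le[of i f] by simp
qed

lemma tangent_degree_eq: "tangent_degree \<mu> \<nu> = degree \<phi>"
  using degree_eq_tangent by (simp only: mu.val_degree_eq)

lemma degree_less: "degree \<phi> < degree \<psi>"
  using tangent_less by (simp only: tangent_degree_eq nu.val_degree_eq)

lemma low_eq: "degree f < degree \<phi> \<Longrightarrow> \<mu> f = \<nu> f"
  using below_tangent_degree[OF mu.valuation_axioms nu.valuation_axioms le]
  by (simp only: tangent_degree_eq)

lemma low_limit: "degree f < degree \<psi> \<Longrightarrow> eventually (\<lambda>i. \<rho> i f = \<nu> f) (tails r)"
  unfolding nu_eq using base.stableD[OF base.low_stable[of f]] base.aug.low[of f] by simp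

lemma key_value: "\<nu> \<phi> = \<mu> \<phi>"
  using key_not_tangent mu.monic le[of \<phi>] by (auto simp: tangent_direction_def tangent_degree_eq)

text \<open>
  A polynomial \<open>Q\<close> of the tangent direction has degree \<open>deg \<phi>\<close> and is stable with a value larger
  than \<open>\<mu>(Q)\<close>. A member with key polynomial of larger degree would not change the value of \<open>Q\<close>.
\<close>

lemma key_degree: "eventually (\<lambda>i. i \<in> Field r \<and> degree (base.key i) = degree \<phi>) (tails r)"
proof -
  obtain i where i: "i \<in> Field r" using base.nonempty by blast
  interpret i: key_valuation v "\<rho> i" "base.key i" using i by (rule base.member_key)
  have "\<mu> (base.key i) < \<nu> (base.key i)"
    using base.member_augmentation(2)[OF i] member_le[OF i] by (rule less_le_trans)
  then obtain Q where Q: "Q \<in> tangent_direction \<mu> \<nu>"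
    using i.monic by (metis tangent_direction_nonempty)
  then have Qd: "degree Q = degree \<phi>" and Ql: "\<mu> Q < \<nu> Q"
    by (simp_all add: tangent_direction_def tangent_degree_eq)
  have "degree Q < degree \<psi>" using degree_less by (simp only: Qd)
  then have "eventually (\<lambda>j. \<rho> j Q = \<nu> Q \<and> (i, j) \<in> r) (tails r)"
    by (intro eventually_conj low_limit base.eventually_ge i)
  then show ?thesis
  proof (rule eventually_mono)
    fix j assume j: "\<rho> j Q = \<nu> Q \<and> (i, j) \<in> r"
    then have jf: "j \<in> Field r" using base.in_Field by blast
    have "\<not> degree Q < degree (base.key j)" using base.member_low[OF jf, of Q] j Ql by auto
    moreover have "degree \<phi> \<le> degree (base.key j)"
      using base.member_augmentation(1)[OF jf] by (rule mu.degree_KP)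
    ultimately show "j \<in> Field r \<and> degree (base.key j) = degree \<phi>" using jf Qd by simp
  qed
qed

lemma good_member:
  assumes "degree f < degree \<psi>"
  obtains i where "i \<in> Field r" "degree (base.key i) = degree \<phi>" "lead_coeff (base.key i) = 1" "\<rho> i f = \<nu> f"
proof -
  obtain i where i: "i \<in> Field r" "(i \<in> Field r \<and> degree (base.key i) = degree \<phi>) \<and> \<rho> i f = \<nu> f"
    using base.eventually_exists[OF eventually_conj[OF key_degree low_limit[OF assms]]] by blast
  interpret i: key_valuation v "\<rho> i" "base.key i" using i(1) by (rule base.member_key)
  show ?thesis using that i i.monic by blast
qed

lemma later_member:
  assumes "i \<in> Field r"
  obtains j where "(i, j) \<in> r" "j \<noteq> i" "degree (base.key j) = degree \<phi>" "lead_coeff (base.key j) = 1"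
proof -
  obtain j where j: "(i, j) \<in> r" "j \<noteq> i" using base.no_last[OF assms] by blast
  then have "eventually (\<lambda>k. (i \<in> Field r \<and> degree (base.key k) = degree \<phi>) \<and> (j, k) \<in> r) (tails r)"
    by (intro eventually_conj eventually_mono[OF key_degree] base.eventually_ge base.in_Field) auto
  then obtain k where k: "k \<in> Field r" "degree (base.key k) = degree \<phi>" "(j, k) \<in> r"
    using base.eventually_exists by blast
  interpret k: key_valuation v "\<rho> k" "base.key k" using k(1) by (rule base.member_key)
  have "(i, k) \<in> r" using j(1) k(3) by (rule base.transitive)
  moreover have "k \<noteq> i" using base.antisymmetric j k(3) by blast
  ultimately show ?thesis using that k(2) k.monic by blast
qed

text \<open>
  Otherwise \<open>\<rho>\<^sub>j \<le> \<rho>\<^sub>i\<close> by comparing both at the key polynomial of \<open>j\<close>, against the order of the family.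
\<close>

lemma key_values_increase:
  assumes "(i, j) \<in> r" "j \<noteq> i" "degree (base.key i) = degree (base.key j)"
  shows "\<rho> i (base.key i) < \<rho> j (base.key j)"
proof (rule ccontr)
  have F: "i \<in> Field r" "j \<in> Field r" using assms(1) base.in_Field by auto
  interpret i: key_valuation v "\<rho> i" "base.key i" by (rule base.member_key[OF F(1)])
  interpret j: key_valuation v "\<rho> j" "base.key j" by (rule base.member_key[OF F(2)])
  let ?a = "base.key j - base.key i"
  assume n: "\<not> ?thesis"
  have "degree ?a < degree (base.key j)"
    by (rule monic_diff_degree[OF j.monic i.monic assms(3)[symmetric] j.deg_pos])
  then have a: "\<rho> i ?a = \<mu> ?a" "\<rho> j ?a = \<mu> ?a"
    using base.member_low[OF F(1), of ?a] base.member_low[OF F(2), of ?a] by (simp_all only: assms(3))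
  have "\<rho> j (base.key j) \<le> \<rho> j (base.key i)"
    using n base.increasing[OF assms(1), of "base.key i"] by simp
  then have "\<rho> j (base.key j) \<le> \<rho> j ?a" by (intro j.ge_diff) simp_all
  then have "\<rho> j (base.key j) \<le> \<rho> i (?a + base.key i)" using n a by (intro i.ge_add) simp_all
  then have "\<rho> j (base.key j) \<le> \<rho> i (base.key j)" by simp
  then have "augment \<mu> (base.key j) (\<rho> j (base.key j)) f \<le> \<rho> i f" for f
    using base.member_ge[OF F(1)] by (intro i.augment_le_valuation[OF j.deg_pos]) simp_all
  then have "\<rho> j \<le> \<rho> i" using base.member_augmentation(3)[OF F(2)] by (simp add: le_fun_def)
  then show False using base.order_iff[OF F(2,1)] base.antisymmetric[OF assms(1)] assms(2) by simp
qed

end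

text \<open>
  The valuation \<open>w\<close> stands for the final valuation of the chain, which lies above \<open>\<nu>\<close> and agrees
  with it below the degree of \<open>\<psi>\<close>.
\<close>

locale limit_step_below = limit_step v \<mu> \<phi> r \<rho> \<psi> \<gamma> \<nu> + w: valuation v w
  for v :: "'k::field \<Rightarrow> 'g::linordered_ab_group_add infty" and \<mu> \<phi>
    and r :: "'i rel" and \<rho> \<psi> \<gamma> \<nu> and w :: "('k, 'g) pmap" +
  assumes below: "\<nu> f \<le> w f" and below_eq: "degree f < degree \<psi> \<Longrightarrow> \<nu> f = w f"
begin

text \<open>
  A member \<open>\<rho>\<^sub>i\<close> that has reached the value of \<open>Q\<close> bounds it by the value of its own key polynomial, and a
  later key polynomial of the same degree has a larger value.
\<close>

lemma no_maximal_value: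
  assumes "lead_coeff Q = 1" "degree Q = degree \<phi>"
  obtains Q' where "lead_coeff Q' = 1" "degree Q' = degree \<phi>" "w Q < w Q'"
proof -
  have Qd: "degree Q < degree \<psi>" using degree_less by (simp only: assms)
  obtain i where i: "i \<in> Field r" "degree (base.key i) = degree \<phi>" "lead_coeff (base.key i) = 1"
    "\<rho> i Q = \<nu> Q" using Qd by (rule good_member)
  obtain j where j: "(i, j) \<in> r" "j \<noteq> i" "degree (base.key j) = degree \<phi>" "lead_coeff (base.key j) = 1"
    using i(1) by (rule later_member)
  interpret i: key_valuation v "\<rho> i" "base.key i" by (rule base.member_key[OF i(1)])
  have "w Q = \<rho> i Q" using below_eq[OF Qd] i(4) by simp
  also have "\<dots> \<le> \<rho> i (base.key i)"
    using assms(1) by (rule i.monic_value_le) (simp only: assms i)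
  also have "\<dots> < \<rho> j (base.key j)"
    using j(1,2) by (rule key_values_increase) (simp only: i j)
  also have "\<dots> \<le> w (base.key j)"
    using member_le[OF base.in_Field(2)[OF j(1)]] below order_trans by blast
  finally show ?thesis using that j by blast
qed

lemma low_eq_w: "degree f < degree \<phi> \<Longrightarrow> \<mu> f = w f"
  using low_eq[of f] below_eq[of f] degree_less by simp

lemma key_value_w: "w \<phi> = \<mu> \<phi>"
  using key_value below_eq[of \<phi>] degree_less by simp

lemma near_tangent:
  assumes "Q \<in> near w (degree \<phi>) (w \<phi>)"
  shows "tangent v \<mu> w Q"
proof
  have Q: "lead_coeff Q = 1" "degree Q = degree \<phi>" "w \<phi> < w Q" by (rule nearD[OF assms])+
  show "\<mu> f \<le> w f" for f using le[of f] below[of f] by simp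
  show "lead_coeff Q = 1" by fact
  show "degree Q > 0" using mu.deg_pos by (simp only: Q)
  show "\<mu> a = w a" if "degree a < degree Q" for a using that low_eq_w[of a] by (simp only: Q)
  show "a = 0" if "degree a < degree Q" "w a = Infty" for a
    using that mu.finite_low[of a] low_eq_w[of a] by (simp add: Q)
  show "\<mu> Q < w Q" using mu.monic_value_le[OF Q(1,2)] Q(3) key_value_w by simp
qed

lemma near_key:
  assumes "Q \<in> near w (degree \<phi>) (w \<phi>)"
  shows "key_valuation v (truncated w Q) Q"
proof -
  interpret tangent v \<mu> w Q using assms by (rule near_tangent)
  show ?thesis unfolding truncated_def by (rule trunc.key_valuation_axioms)
qed

lemma near_above:
  assumes "lead_coeff Q = 1" "degree Q = degree \<phi>"
  obtains Q' where "Q' \<in> near w (degree \<phi>) (w \<phi>)" "w Q \<le> w Q'"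
proof (cases "w \<phi> < w Q")
  case True
  then show ?thesis using that[of Q] assms unfolding near_def by blast
next
  case False
  obtain Q' where "lead_coeff Q' = 1" "degree Q' = degree \<phi>" "w \<phi> < w Q'"
    using mu.monic refl by (rule no_maximal_value)
  then show ?thesis using that[of Q'] False unfolding near_def by fastforce
qed

lemma member_le_truncated:
  assumes i: "i \<in> Field r" "degree (base.key i) = degree \<phi>"
    and Q: "Q \<in> near w (degree \<phi>) (w \<phi>)" "w (base.key i) \<le> w Q"
  shows "\<rho> i f \<le> truncated w Q f"
proof -
  interpret i: key_valuation v "\<rho> i" "base.key i" by (rule base.member_key[OF i(1)])
  interpret Q: key_valuation v "truncated w Q" Q using Q(1) by (rule near_key)
  have Qd: "degree Q = degree \<phi>" using Q(1) by (simp add: near_def)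
  have "\<rho> i (base.key i) \<le> w (base.key i)" using member_le[OF i(1)] below order_trans by blast
  also have "\<dots> = truncated w (base.key i) (base.key i)" using i.deg_pos by (simp add: w.truncated_key)
  also have "\<dots> \<le> truncated w Q (base.key i)"
    by (rule w.truncated_mono[OF Q.key_valuation_axioms i.monic _ Q(2)]) (simp only: i Qd)
  finally have "augment \<mu> (base.key i) (\<rho> i (base.key i)) f \<le> truncated w Q f"
    using Qd i(2) by (intro Q.augment_le_valuation[OF i.deg_pos]) (simp_all add: w.truncated_low low_eq_w)
  then show ?thesis by (simp only: base.member_augmentation(3)[OF i(1), symmetric])
qed

text \<open>
  A minimal polynomial differs from the limit key polynomial \<open>\<psi>\<close> by a stable polynomial of value at
  least \<open>\<gamma>\<close>, which exceeds all values of \<open>\<psi>\<close> in the family.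
\<close>

lemma minimal_poly_unstable:
  assumes "p \<in> minimal_polys \<nu>"
  shows "\<not> stable r \<rho> p"
proof
  assume st: "stable r \<rho> p"
  let ?e = "p - \<psi>"
  note p = nu.minimal_polysD[OF assms]
  have "degree p > 0" using nu.deg_pos by (simp only: p)
  then have "degree ?e < degree p" by (rule monic_diff_degree[OF p(1) nu.monic p(2)])
  then have "degree ?e < degree \<psi>" by (simp only: p)
  then have "eventually (\<lambda>i. \<rho> i ?e = \<nu> ?e \<and> \<rho> i p = stable_limit r \<rho> p) (tails r)"
    by (intro eventually_conj low_limit base.stableD st)
  then obtain k where k: "k \<in> Field r"
    "\<And>i. (k, i) \<in> r \<Longrightarrow> \<rho> i ?e = \<nu> ?e \<and> \<rho> i p = stable_limit r \<rho> p"
    unfolding base.eventually_tails by blast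
  have "\<rho> i \<psi> = stable_limit r \<rho> p" if i: "(k, i) \<in> r" for i
  proof -
    have F: "i \<in> Field r" using i by (rule base.in_Field)
    interpret i: valuation v "\<rho> i" using F by (rule base.member_valuation)
    have "\<rho> i \<psi> < \<gamma>" using F by (rule base.above)
    also have "\<gamma> = \<nu> \<psi>" unfolding nu_eq by (rule base.aug.aug_key[symmetric])
    also have "\<dots> \<le> \<rho> i ?e" using p(3) k(2)[OF i] by simp
    finally have "\<rho> i (\<psi> + ?e) = \<rho> i \<psi>" by (rule i.add_eq)
    then show ?thesis using k(2)[OF i] by simp
  qed
  then have "eventually (\<lambda>i. \<rho> i \<psi> = stable_limit r \<rho> p) (tails r)"
    unfolding base.eventually_tails using k(1) by blast
  then show False using base.unstable base.stableI by blast
qed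

text \<open>
  Every truncation in the tangent direction lies below a member of the family (one that has reached
  the value of \<open>Q\<close>) and every late member below such a truncation, so stability and instability carry over.
\<close>

lemma is_limit_direction:
  assumes "p \<in> minimal_polys \<nu>"
  shows "limit_direction v w (degree \<phi>) (w \<phi>) p"
proof (intro limit_direction.intro limit_direction_axioms.intro w.valuation_axioms)
  note p = nu.minimal_polysD[OF assms]
  show "lead_coeff p = 1" by (rule p)
  show "degree p > 0" using nu.deg_pos by (simp only: p)
  show "key_valuation v (truncated w Q) Q" if "Q \<in> near w (degree \<phi>) (w \<phi>)" for Q
    using that by (rule near_key)
  show "\<exists>Q'. lead_coeff Q' = 1 \<and> degree Q' = degree \<phi> \<and> w Q < w Q'"
    if "lead_coeff Q = 1" "degree Q = degree \<phi>" for Q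
    using no_maximal_value[OF that] by metis
  show "\<exists>Q\<in>near w (degree \<phi>) (w \<phi>). truncated w Q f = w f" if "degree f < degree p" for f
  proof -
    have fd: "degree f < degree \<psi>" using that by (simp only: p)
    then obtain i where i: "i \<in> Field r" "degree (base.key i) = degree \<phi>"
      "lead_coeff (base.key i) = 1" "\<rho> i f = \<nu> f" by (rule good_member)
    obtain Q where Q: "Q \<in> near w (degree \<phi>) (w \<phi>)" "w (base.key i) \<le> w Q"
      using i(3,2) by (rule near_above)
    have "w f \<le> truncated w Q f"
      using member_le_truncated[OF i(1,2) Q, of f] i(4) below_eq[OF fd] by simp
    moreover have "truncated w Q f \<le> w f"
      by (rule w.truncated_le) (rule tangent.deg_pos[OF near_tangent[OF Q(1)]])
    ultimately show ?thesis using Q(1) antisym by blast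
  qed
  show "\<exists>Q'\<in>near w (degree \<phi>) (w \<phi>). truncated w Q p < truncated w Q' p"
    if Q: "Q \<in> near w (degree \<phi>) (w \<phi>)" for Q
  proof -
    have Q': "lead_coeff Q = 1" "degree Q = degree \<phi>" by (rule nearD[OF Q])+
    have Qd: "degree Q < degree \<psi>" using degree_less by (simp only: Q')
    then obtain i where i: "i \<in> Field r" "degree (base.key i) = degree \<phi>"
      "lead_coeff (base.key i) = 1" "\<rho> i Q = \<nu> Q" by (rule good_member)
    interpret i: key_valuation v "\<rho> i" "base.key i" by (rule base.member_key[OF i(1)])
    have Q_le: "truncated w Q p \<le> \<rho> i p"
      unfolding truncated_def
    proof (rule i.augment_le_valuation)
      show "degree Q > 0" using mu.deg_pos by (simp only: Q')
      show "w a \<le> \<rho> i a" if "degree a < degree Q" for a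
        using that base.member_ge[OF i(1), of a] low_eq_w[of a] by (simp only: Q')
      show "w Q \<le> \<rho> i Q" using i(4) below_eq[OF Qd] by simp
    qed simp
    obtain j where j: "(i, j) \<in> r" "\<rho> i p < \<rho> j p"
      using base.unstable_grows[OF minimal_poly_unstable[OF assms] i(1)] by blast
    obtain k where k: "(j, k) \<in> r" "degree (base.key k) = degree \<phi>" "lead_coeff (base.key k) = 1"
      using base.in_Field(2)[OF j(1)] by (metis later_member)
    obtain R where R: "R \<in> near w (degree \<phi>) (w \<phi>)" "w (base.key k) \<le> w R"
      using k(3,2) by (rule near_above)
    have "truncated w Q p < \<rho> j p" using Q_le j(2) by simp
    also have "\<dots> \<le> \<rho> k p" by (rule base.increasing[OF k(1)])
    also have "\<dots> \<le> truncated w R p"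
      by (rule member_le_truncated[OF base.in_Field(2)[OF k(1)] k(2) R])
    finally show ?thesis using R(1) by blast
  qed
qed

text \<open>
  Since \<open>\<phi>\<close> is not in the tangent direction, its value does not grow. If the value of \<open>Q\<close> grows, then the
  difference \<open>Q - \<phi>\<close>, whose value does not, cannot have a smaller value than \<open>\<phi>\<close>.
\<close>

lemma tangent_direction_eq: "tangent_direction \<mu> \<nu> = near w (degree \<phi>) (w \<phi>)"
proof -
  have "\<mu> Q < \<nu> Q \<longleftrightarrow> w \<phi> < w Q" if Q: "lead_coeff Q = 1" "degree Q = degree \<phi>" for Q
  proof
    have Qw: "\<nu> Q = w Q" using below_eq[of Q] degree_less Q by simp
    assume lt: "\<mu> Q < \<nu> Q"
    have dQ: "degree Q > 0" using mu.deg_pos by (simp only: Q)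
    have da: "degree (Q - \<phi>) < degree \<phi>"
      using monic_diff_degree[OF Q(1) mu.monic Q(2) dQ] by (simp only: Q)
    have "w \<phi> \<le> \<mu> (Q - \<phi>)"
    proof (rule ccontr)
      assume "\<not> ?thesis"
      then have a: "\<mu> (Q - \<phi>) < \<mu> \<phi>" "\<nu> (Q - \<phi>) < \<nu> \<phi>"
        using key_value_w key_value low_eq[OF da] by simp_all
      have "\<mu> (Q - \<phi> + \<phi>) = \<nu> (Q - \<phi> + \<phi>)"
        unfolding mu.add_eq[OF a(1)] nu.add_eq[OF a(2)] by (rule low_eq[OF da])
      then show False using lt by simp
    qed
    then have "w \<phi> \<le> \<mu> (Q - \<phi> + \<phi>)" using key_value_w by (intro mu.ge_add) simp_all
    then show "w \<phi> < w Q" using lt Qw by simp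
  next
    assume "w \<phi> < w Q"
    then show "\<mu> Q < \<nu> Q"
      using mu.monic_value_le[OF Q] key_value_w below_eq[of Q] degree_less Q by simp
  qed
  then show ?thesis unfolding tangent_direction_def near_def tangent_degree_eq by blast
qed

lemma defect_near:
  obtains p where "p \<in> minimal_polys \<nu>"
    "defect \<mu> \<nu> = (LEAST d. \<exists>Q\<in>near w (degree \<phi>) (w \<phi>). d = expansion_degree (truncated w Q) Q p)"
proof -
  have "augment \<mu> Q (\<nu> Q) = truncated w Q" if "Q \<in> tangent_direction \<mu> \<nu>" for Q
  proof -
    have n: "Q \<in> near w (degree \<phi>) (w \<phi>)" using that by (simp only: tangent_direction_eq)
    then have Qd: "degree Q = degree \<phi>" by (simp add: near_def)
    interpret tangent v \<mu> w Q using n by (rule near_tangent)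
    have "\<nu> Q = w Q" using below_eq[of Q] degree_less Qd by simp
    then show ?thesis unfolding truncated_def using augment_cong[OF deg_pos low_eq] by simp
  qed
  then have "defect \<mu> \<nu> = (LEAST d. \<exists>Q\<in>near w (degree \<phi>) (w \<phi>).
      d = expansion_degree (truncated w Q) Q (SOME p. p \<in> minimal_polys \<nu>))"
    using defect_eq[of \<mu> \<nu> "truncated w"] by (simp only: tangent_direction_eq)
  moreover have "(SOME p. p \<in> minimal_polys \<nu>) \<in> minimal_polys \<nu>"
    using nu.key_in_minimal_polys by (rule someI)
  ultimately show ?thesis using that by blast
qed

end


section \<open>Comparing the steps of two chains\<close>

locale ordinary_step_below = ordinary_step v \<mu> \<phi> \<psi> \<gamma> \<nu> + w: valuation v w
  for v :: "'k::field \<Rightarrow> 'g::linordered_ab_group_add infty" and \<mu> \<phi> \<psi> \<gamma> \<nu>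
    and w :: "('k, 'g) pmap" +
  assumes below: "\<nu> f \<le> w f" and below_eq: "degree f < degree \<psi> \<Longrightarrow> \<nu> f = w f"
begin

lemma low_eq_w: "degree f < degree \<psi> \<Longrightarrow> w f = \<mu> f"
  using low_eq[of f] below_eq[of f] by simp

lemma mu_eq_truncated: "\<mu> = truncated w \<phi>"
proof -
  have "truncated w \<phi> = augment \<mu> \<phi> (w \<phi>)"
    unfolding truncated_def
    by (rule augment_cong[OF mu.deg_pos]) (use degree_less in \<open>simp add: low_eq_w\<close>)
  then show ?thesis using degree_less by (simp add: low_eq_w mu.self)
qed

lemma maximal_value:
  assumes "lead_coeff Q = 1" "degree Q = degree \<phi>"
  shows "w Q \<le> w \<phi>"
  using mu.monic_value_le[OF assms] low_eq_w[of Q] low_eq_w[of \<phi>] degree_less assms(2) by simp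

text \<open>This describes the next degree without the next valuation.\<close>

lemma tangent_degree_w: "tangent_degree \<mu> w = degree \<psi>"
proof (rule tangent_degree_eqI)
  show "\<mu> \<psi> < w \<psi>" using key_less below by (rule less_le_trans)
qed (simp_all only: nu.monic low_eq_w)

end

text \<open>
  Both key polynomials attain the same maximal value, so the two truncations coincide, and the next
  degree is the tangent degree from this common truncation to \<open>w\<close>.
\<close>

lemma ordinary_steps_degree_eq:
  assumes "ordinary_step_below v \<mu> \<phi> \<psi> \<gamma> \<nu> w" "ordinary_step_below v \<mu>' \<phi>' \<psi>' \<gamma>' \<nu>' w"
    "degree \<phi> = degree \<phi>'"
  shows "degree \<psi> = degree \<psi>'"
proof -
  interpret C: ordinary_step_below v \<mu> \<phi> \<psi> \<gamma> \<nu> w by fact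
  interpret D: ordinary_step_below v \<mu>' \<phi>' \<psi>' \<gamma>' \<nu>' w by fact
  have "w \<phi> \<le> w \<phi>'" by (rule D.maximal_value[OF C.mu.monic assms(3)])
  moreover have "w \<phi>' \<le> w \<phi>" by (rule C.maximal_value[OF D.mu.monic assms(3)[symmetric]])
  moreover have "key_valuation v (truncated w \<phi>) \<phi>" "key_valuation v (truncated w \<phi>') \<phi>'"
    using C.mu.key_valuation_axioms D.mu.key_valuation_axioms
    by (simp_all only: C.mu_eq_truncated[symmetric] D.mu_eq_truncated[symmetric])
  ultimately have "truncated w \<phi> f = truncated w \<phi>' f" for f
    using C.mu.monic D.mu.monic assms(3) by (intro antisym C.w.truncated_mono) simp_all
  then have "\<mu> = \<mu>'" unfolding C.mu_eq_truncated D.mu_eq_truncated by blast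
  then show ?thesis using C.tangent_degree_w D.tangent_degree_w by simp
qed

lemma ordinary_limit_exclusive:
  assumes "ordinary_step_below v \<mu> \<phi> \<psi> \<gamma> \<nu> w" "limit_step_below v \<mu>' \<phi>' r \<rho> \<psi>' \<gamma>' \<nu>' w"
  shows "degree \<phi> \<noteq> degree \<phi>'"
proof
  interpret C: ordinary_step_below v \<mu> \<phi> \<psi> \<gamma> \<nu> w by fact
  interpret D: limit_step_below v \<mu>' \<phi>' r \<rho> \<psi>' \<gamma>' \<nu>' w by fact
  assume eq: "degree \<phi> = degree \<phi>'"
  obtain Q where "lead_coeff Q = 1" "degree Q = degree \<phi>'" "w \<phi> < w Q"
    using C.mu.monic eq by (rule D.no_maximal_value)
  then show False using C.maximal_value[of Q] eq by auto
qed

lemma limit_steps_eq: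
  assumes "limit_step_below v \<mu> \<phi> r \<rho> \<psi> \<gamma> \<nu> w" "limit_step_below v \<mu>' \<phi>' r' \<rho>' \<psi>' \<gamma>' \<nu>' w"
    "degree \<phi> = degree \<phi>'"
  shows "degree \<psi> = degree \<psi>'" "defect \<mu> \<nu> = defect \<mu>' \<nu>'"
proof -
  interpret C: limit_step_below v \<mu> \<phi> r \<rho> \<psi> \<gamma> \<nu> w by fact
  interpret D: limit_step_below v \<mu>' \<phi>' r' \<rho>' \<psi>' \<gamma>' \<nu>' w by fact
  show "degree \<psi> = degree \<psi>'"
    by (rule limit_direction_degree_eq[OF C.is_limit_direction[OF C.nu.key_in_minimal_polys]
          D.is_limit_direction[OF D.nu.key_in_minimal_polys, folded assms(3)]])
  obtain p where p: "p \<in> minimal_polys \<nu>" "defect \<mu> \<nu> =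
      (LEAST d. \<exists>Q\<in>near w (degree \<phi>) (w \<phi>). d = expansion_degree (truncated w Q) Q p)"
    by (rule C.defect_near)
  obtain p' where p': "p' \<in> minimal_polys \<nu>'" "defect \<mu>' \<nu>' =
      (LEAST d. \<exists>Q\<in>near w (degree \<phi>') (w \<phi>'). d = expansion_degree (truncated w Q) Q p')"
    by (rule D.defect_near)
  show "defect \<mu> \<nu> = defect \<mu>' \<nu>'"
    unfolding p(2) p'(2) assms(3)
    by (rule limit_direction_defect_eq[OF C.is_limit_direction[OF p(1), unfolded assms(3)]
          D.is_limit_direction[OF p'(1)]])
qed


section \<open>Mac Lane--Vaquie chains\<close>

text \<open>
  Small polynomials are constants here, and products of constants leave no quotient by \<open>x - \<alpha>\<close>.
\<close>

lemma depth_zero_key_valuation: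
  assumes "field_valuation v"
  shows "key_valuation v (depth_zero v \<alpha> \<gamma>) [:- \<alpha>, 1:]"
proof -
  have "augmentable v (\<lambda>c. v (coeff c 0)) [:- \<alpha>, 1:] \<gamma>"
  proof -
    have v: "v x = Infty \<longleftrightarrow> x = 0" "v (x * y) = v x + v y" "min (v x) (v y) \<le> v (x + y)" for x y
      using assms by (simp_all add: field_valuation_def)
    have c: "\<exists>x. a = [:x:]" if "degree a < 1" for a :: "'a poly"
      using that degree_eq_zeroE[of a] by auto
    have "v (coeff (a * b mod [:- \<alpha>, 1:]) 0) = v (coeff a 0) + v (coeff b 0) \<and>
        v (coeff a 0) + v (coeff b 0) < \<gamma> + v (coeff (a * b div [:- \<alpha>, 1:]) 0)"
      if ab: "degree a < 1" "degree b < 1" "a \<noteq> 0" "b \<noteq> 0" for a b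
    proof -
      obtain x y where xy: "a = [:x:]" "b = [:y:]" using c ab by metis
      then have "a * b = [:x * y:]" by simp
      moreover have "[:x * y:] mod [:- \<alpha>, 1:] = [:x * y:]" by (rule mod_poly_less) simp
      moreover have "[:x * y:] div [:- \<alpha>, 1:] = 0" by (rule div_poly_less) simp
      ultimately have "a * b mod [:- \<alpha>, 1:] = [:x * y:]" "a * b div [:- \<alpha>, 1:] = 0"
        by (simp_all only:)
      then show ?thesis
        using ab xy v(1)[of 0] v(1)[of x] v(1)[of y] v(2)[of x y] by (simp del: mult_pCons_left)
    qed
    moreover have "a = 0" if "degree a < 1" "v (coeff a 0) = Infty" for a
      using c[OF that(1)] that(2) v(1) by auto
    ultimately show ?thesis unfolding augmentable_def using v(3) by simp
  qed
  then interpret augmentable_at v "\<lambda>c. v (coeff c 0)" "[:- \<alpha>, 1:]" \<gamma>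
    by unfold_locales (rule assms)
  show ?thesis unfolding depth_zero_def by (rule key_valuation_augment)
qed

locale mlv =
  fixes v :: "'k::field \<Rightarrow> 'g::linordered_ab_group_add infty"
    and C :: "('k, 'g, 'i) chain" and w :: "('k, 'g) pmap"
  assumes field_val: "field_valuation v" and poly_val: "poly_valuation v w"
    and chain_of: "mlv_chain_of v C w"
begin

sublocale w: valuation v w
  by unfold_locales (rule field_val, rule poly_val)

lemma chain: "mlv_chain v C"
  using chain_of by (simp add: mlv_chain_of_def)

lemma step_cases:
  assumes "enat n < num_steps C" "key_valuation v (val C n) (kpoly C n)"
  shows "ordinary_step v (val C n) (kpoly C n) (kpoly C (Suc n)) (kval C (Suc n)) (val C (Suc n)) \<or>
    (\<exists>(r :: 'i rel) \<rho>. limit_step v (val C n) (kpoly C n) r \<rho> (kpoly C (Suc n)) (kval C (Suc n)) (val C (Suc n)))"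
proof -
  have s: "mlv_step v C n" using chain assms(1) by (simp add: mlv_chain_def)
  show ?thesis
  proof (cases "nature C n")
    case Ordinary
    then show ?thesis using s assms(2)
      by (auto simp: mlv_step_def Let_def ordinary_step_def ordinary_step_axioms_def)
  next
    case (Limit r \<rho>)
    then have "limit_step v (val C n) (kpoly C n) r \<rho> (kpoly C (Suc n)) (kval C (Suc n)) (val C (Suc n))"
      using s assms(2) by (auto simp: mlv_step_def Let_def limit_step_def limit_step_axioms_def)
    then show ?thesis by blast
  qed
qed

lemma step_facts:
  assumes "enat n < num_steps C" "key_valuation v (val C n) (kpoly C n)"
  shows "key_valuation v (val C (Suc n)) (kpoly C (Suc n))"
    and "val C n f \<le> val C (Suc n) f"
    and "degree (kpoly C n) < degree (kpoly C (Suc n))"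
    and "degree f < degree (kpoly C n) \<Longrightarrow> val C n f = val C (Suc n) f"
proof -
  have "key_valuation v (val C (Suc n)) (kpoly C (Suc n)) \<and> val C n f \<le> val C (Suc n) f \<and>
    degree (kpoly C n) < degree (kpoly C (Suc n)) \<and>
    (degree f < degree (kpoly C n) \<longrightarrow> val C n f = val C (Suc n) f)" (is ?facts)
    using step_cases[OF assms]
  proof (elim disjE exE)
    assume "ordinary_step v (val C n) (kpoly C n) (kpoly C (Suc n)) (kval C (Suc n)) (val C (Suc n))"
    then interpret ordinary_step v "val C n" "kpoly C n" "kpoly C (Suc n)" "kval C (Suc n)" "val C (Suc n)" .
    show ?facts
      using nu.key_valuation_axioms le low_eq[of f] degree_less by simp
  next
    fix r \<rho>
    assume "limit_step v (val C n) (kpoly C n) r \<rho> (kpoly C (Suc n)) (kval C (Suc n)) (val C (Suc n))"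
    then interpret limit_step v "val C n" "kpoly C n" r \<rho> "kpoly C (Suc n)" "kval C (Suc n)" "val C (Suc n)" .
    show ?facts
      using nu.key_valuation_axioms le low_eq[of f] degree_less by simp
  qed
  then show "key_valuation v (val C (Suc n)) (kpoly C (Suc n))" "val C n f \<le> val C (Suc n) f"
    "degree (kpoly C n) < degree (kpoly C (Suc n))"
    "degree f < degree (kpoly C n) \<Longrightarrow> val C n f = val C (Suc n) f"
    by blast+
qed

lemma start: "key_valuation v (val C 0) (kpoly C 0)" "degree (kpoly C 0) = 1"
  using chain depth_zero_key_valuation[OF field_val] by (auto simp: mlv_chain_def)

lemma Suc_steps: "enat (Suc n) \<le> num_steps C \<Longrightarrow> enat n < num_steps C"
  by (simp add: Suc_ile_eq)

lemma node: "enat n \<le> num_steps C \<Longrightarrow> key_valuation v (val C n) (kpoly C n)"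
proof (induction n)
  case (Suc n)
  then have "enat n < num_steps C" by (intro Suc_steps)
  then show ?case using Suc.IH by (intro step_facts(1)) auto
qed (rule start)

text \<open>
  The degrees of the key polynomials increase along the chain, so a step changes no values below
  the degree reached before it.
\<close>

lemma chain_mono:
  assumes "k \<le> n" "enat n \<le> num_steps C"
  shows "val C k f \<le> val C n f \<and> degree (kpoly C k) \<le> degree (kpoly C n) \<and>
    (degree f < degree (kpoly C k) \<longrightarrow> val C k f = val C n f)"
  using assms
proof (induction n rule: dec_induct)
  case (step n)
  then have lt: "enat n < num_steps C" by (intro Suc_steps)
  note s = step_facts[OF lt node[OF less_imp_le[OF lt]]]
  show ?case using step.IH[OF less_imp_le[OF lt]] s(2,4)[of f] s(3) by auto
qed simp

lemma below:
  assumes n: "enat n \<le> num_steps C"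
  shows "val C n f \<le> w f" and "degree f < degree (kpoly C n) \<Longrightarrow> val C n f = w f"
proof -
  have "val C n f \<le> w f \<and> (degree f < degree (kpoly C n) \<longrightarrow> val C n f = w f)"
    using chain_of unfolding mlv_chain_of_def
  proof (elim conjE disjE)
    assume "chain_type1 C w"
    then obtain N where "num_steps C = enat N" "val C N = w" by (auto simp: chain_type1_def)
    then show ?thesis using chain_mono[of n N f] n by auto
  next
    assume "chain_type3 C w"
    then obtain N where inf: "num_steps C = \<infinity>" and N: "\<And>k. k \<ge> N \<Longrightarrow> val C k f = w f"
      unfolding chain_type3_def by blast
    then show ?thesis using chain_mono[of n "max n N" f] N[of "max n N"] by auto
  next
    assume "chain_type2 v C w"
    then obtain N and r :: "'i rel" and \<rho> where N: "num_steps C = enat N"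
      and cont: "continuous_augmentations v (val C N) r \<rho>"
      and stable: "\<And>f. stable r \<rho> f" and lim: "w = stable_limit r \<rho>"
      and deg: "tangent_degree (val C N) w = val_degree (val C N)"
      unfolding chain_type2_def by blast
    interpret N: key_valuation v "val C N" "kpoly C N" by (rule node) (simp add: N)
    interpret augmentation_family v "val C N" r \<rho> by unfold_locales (rule cont)
    obtain i where i: "i \<in> Field r" using nonempty by blast
    have le: "val C N f \<le> w f" for f
      using member_ge[OF i, of f] le_stable_limit[OF stable i, of f] lim by simp
    have "degree f < degree (kpoly C N) \<Longrightarrow> val C N f = w f"
      using below_tangent_degree[OF N.valuation_axioms w.valuation_axioms le]
      by (simp only: deg N.val_degree_eq)
    then show ?thesis using chain_mono[of n N f] n N le[of f] by auto
  qed
  then show "val C n f \<le> w f" "degree f < degree (kpoly C n) \<Longrightarrow> val C n f = w f" by auto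
qed

text \<open>
  The form of a step that the comparison of two chains refers to, with the limit of the chain in
  place of the rest of the chain.
\<close>

lemma step_below_cases:
  assumes n: "enat n < num_steps C"
  obtains (ordinary) "ordinary_step_below v (val C n) (kpoly C n) (kpoly C (Suc n)) (kval C (Suc n)) (val C (Suc n)) w"
  | (limit) r :: "'i rel" and \<rho> where "limit_step_below v (val C n) (kpoly C n) r \<rho> (kpoly C (Suc n)) (kval C (Suc n)) (val C (Suc n)) w"
proof -
  have S: "enat (Suc n) \<le> num_steps C" using n by (simp add: Suc_ile_eq)
  show ?thesis
    using step_cases[OF n node[OF less_imp_le[OF n]]]
  proof (elim disjE exE)
    assume "ordinary_step v (val C n) (kpoly C n) (kpoly C (Suc n)) (kval C (Suc n)) (val C (Suc n))"
    then show ?thesis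
      by (intro ordinary ordinary_step_below.intro ordinary_step_below_axioms.intro below[OF S]
          w.valuation_axioms)
  next
    fix r :: "'i rel" and \<rho>
    assume "limit_step v (val C n) (kpoly C n) r \<rho> (kpoly C (Suc n)) (kval C (Suc n)) (val C (Suc n))"
    then show ?thesis
      by (intro limit limit_step_below.intro limit_step_below_axioms.intro below[OF S]
          w.valuation_axioms)
  qed
qed

end

text \<open>
  The induction step: the first conclusion is its next hypothesis, the second the claim on defects.
\<close>

lemma step_invariants:
  assumes "mlv v C w" "mlv v D w" "enat n < num_steps C" "enat n < num_steps D"
    "degree (kpoly C n) = degree (kpoly D n)"
  shows "degree (kpoly C (Suc n)) = degree (kpoly D (Suc n))"
    "defect (val C n) (val C (Suc n)) = defect (val D n) (val D (Suc n))"
proof -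
  interpret C: mlv v C w by fact
  interpret D: mlv v D w by fact
  have "degree (kpoly C (Suc n)) = degree (kpoly D (Suc n)) \<and>
    defect (val C n) (val C (Suc n)) = defect (val D n) (val D (Suc n))"
  proof (cases rule: C.step_below_cases[OF assms(3), case_names ordinary limit])
    case ordinary
    note c = this
    show ?thesis
    proof (cases rule: D.step_below_cases[OF assms(4), case_names ordinary limit])
      case ordinary
      then show ?thesis
        using ordinary_steps_degree_eq[OF c ordinary assms(5)]
          ordinary_step.defect_eq_1[OF ordinary_step_below.axioms(1)[OF c]]
          ordinary_step.defect_eq_1[OF ordinary_step_below.axioms(1)[OF ordinary]] by simp
    next
      case (limit r \<rho>)
      then show ?thesis using ordinary_limit_exclusive[OF c limit] assms(5) by simp
    qed
  next
    case (limit r \<rho>)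
    note c = this
    show ?thesis
    proof (cases rule: D.step_below_cases[OF assms(4), case_names ordinary limit])
      case ordinary
      then show ?thesis using ordinary_limit_exclusive[OF ordinary c] assms(5) by simp
    next
      case (limit r' \<rho>')
      then show ?thesis using limit_steps_eq[OF c limit assms(5)] by simp
    qed
  qed
  then show "degree (kpoly C (Suc n)) = degree (kpoly D (Suc n))"
    "defect (val C n) (val C (Suc n)) = defect (val D n) (val D (Suc n))" by auto
qed

lemma key_degrees_eq:
  assumes "mlv v C w" "mlv v D w"
  shows "enat n \<le> num_steps C \<Longrightarrow> enat n \<le> num_steps D \<Longrightarrow> degree (kpoly C n) = degree (kpoly D n)"
proof (induction n)
  case 0
  show ?case using mlv.start(2)[OF assms(1)] mlv.start(2)[OF assms(2)] by simp
next
  case (Suc n)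
  then have "enat n < num_steps C" "enat n < num_steps D" by (simp_all add: Suc_ile_eq)
  then show ?case using Suc.IH by (intro step_invariants(1)[OF assms]) auto
qed

theorem theorem2p35:
  fixes v :: "'k::field \<Rightarrow> 'g::linordered_ab_group_add infty"
    and vbar :: "'k alg_closure \<Rightarrow> 'g infty"
    and \<mu> :: "'k poly \<Rightarrow> 'g infty"
    and C :: "('k, 'g, 'i) chain"
    and D :: "('k, 'g, 'j) chain"
  assumes "field_valuation v"
    and "field_valuation vbar"
    and "\<forall>c. vbar (to_ac c) = v c"
    and "poly_valuation v \<mu>"
    and "mlv_chain_of v C \<mu>"
    and "mlv_chain_of v D \<mu>"
    and "enat n < num_steps C"
    and "enat n < num_steps D"
  shows "defect (val C n) (val C (Suc n)) = defect (val D n) (val D (Suc n))"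
proof -
  have C: "mlv v C \<mu>" and D: "mlv v D \<mu>" using assms by (simp_all add: mlv_def)
  have "degree (kpoly C n) = degree (kpoly D n)"
    by (rule key_degrees_eq[OF C D]) (use assms(7,8) in auto)
  then show ?thesis by (rule step_invariants(2)[OF C D assms(7,8)])
qed

end
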